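(* Let $V$ be a valuation domain with quotient field $K$, maximal ideal $M$ and valuation $v$, and let $E=\{s_\nu\}_{\nu\in\Lambda}\subset K$ be a pseudo-monotone sequence. Then $$V_E=\{\phi\in K(X)\mid \phi(s_\nu)\in V,\text{ for all sufficiently large }\nu\in\Lambda\}$$ is a valuation domain with maximal ideal $$M_E=\{\phi\in K(X)\mid \phi(s_\nu)\in M,\text{ for all sufficiently large }\nu\in\Lambda\}.$$
   Context: Sequences $E=\{s_\nu\}_{\nu\in\Lambda}\subset K$ are indexed by well-ordered sets $\Lambda$ without maximum. $E$ is pseudo-convergent if $v(s_\rho-s_\nu)<v(s_\sigma-s_\rho)$ for all $\nu<\rho<\sigma$; pseudo-divergent if $v(s_\rho-s_\nu)>v(s_\sigma-s_\rho)$ for all $\nu<\rho<\sigma$; pseudo-stationary if $v(s_\nu-s_\mu)=v(s_{\nu'}-s_{\mu'})$ for all $\nu\ne\mu$, $\nu'\neq\mu'$; pseudo-monotone if it is one of these three. The condition $\phi(s_\nu)\in V$ includes that $s_\nu$ is not a pole of $\phi$. Here "valuation domain" means a valuation domain of the field $K(X)$. *)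

theory Defs
  imports
    "HOL-Algebra.Algebraic_Closure_Type"
    "HOL-Algebra.Subrings"
    "HOL-Computational_Algebra.Polynomial"
    "HOL-Computational_Algebra.Fraction_Field"
    "HOL-Library.Extended"
begin

text \<open>
  A field is a type \<open>'a :: field\<close>. The ideal-theoretic notions are those of HOL-Algebra, applied to
  the record \<open>ring_of_type_algebra\<close> of that type with its carrier cut down to the subring in question.
\<close>

abbreviation subring_of_field :: "'a::field set \<Rightarrow> 'a ring" where
  "subring_of_field V \<equiv> ring_of_type_algebra\<lparr>carrier := V\<rparr>"

text \<open>The last condition makes the whole type the quotient field of \<open>V\<close>; \<open>V = UNIV\<close> is allowed.\<close>

definition valuation_domain :: "'a::field set \<Rightarrow> bool" where
  "valuation_domain V \<longleftrightarrow>
     subdomain V ring_of_type_algebra \<and> (\<forall>x. x \<noteq> 0 \<longrightarrow> x \<in> V \<or> inverse x \<in> V)"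

definition unique_maximal_ideal :: "'a::field set \<Rightarrow> 'a set \<Rightarrow> bool" where
  "unique_maximal_ideal M V \<longleftrightarrow> (\<forall>I. maximalideal I (subring_of_field V) \<longleftrightarrow> I = M)"

text \<open>
  Additive (Krull) valuations. The value at \<open>0\<close> is \<open>\<infinity>\<close>; the element \<open>-\<infinity>\<close> of the type
  \<open>'g extended\<close> is never a value. The value group is the image of the nonzero elements, a subgroup of
  \<open>'g\<close> of arbitrary rank.
\<close>

definition valuation :: "('a::field \<Rightarrow> 'g::linordered_ab_group_add extended) \<Rightarrow> bool" where
  "valuation v \<longleftrightarrow>
     (\<forall>x. v x \<noteq> -\<infinity>) \<and>
     (\<forall>x. v x = \<infinity> \<longleftrightarrow> x = 0) \<and>
     (\<forall>x y. v (x * y) = v x + v y) \<and>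
     (\<forall>x y. min (v x) (v y) \<le> v (x + y))"

definition valuation_of ::
    "('a::field \<Rightarrow> 'g::linordered_ab_group_add extended) \<Rightarrow> 'a set \<Rightarrow> bool" where
  "valuation_of v V \<longleftrightarrow> valuation v \<and> V = {x. 0 \<le> v x}"

text \<open>
  The comparisons below take place in \<open>'g extended\<close>: repeated terms have difference of value \<open>\<infinity>\<close>,
  so in particular a constant sequence is pseudo-stationary.
\<close>

definition pseudo_convergent ::
    "('a::field \<Rightarrow> 'g::linordered_ab_group_add extended) \<Rightarrow> ('i::wellorder \<Rightarrow> 'a) \<Rightarrow> bool" where
  "pseudo_convergent v s \<longleftrightarrow>
     (\<forall>\<nu> \<rho> \<sigma>. \<nu> < \<rho> \<and> \<rho> < \<sigma> \<longrightarrow> v (s \<rho> - s \<nu>) < v (s \<sigma> - s \<rho>))"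

definition pseudo_divergent ::
    "('a::field \<Rightarrow> 'g::linordered_ab_group_add extended) \<Rightarrow> ('i::wellorder \<Rightarrow> 'a) \<Rightarrow> bool" where
  "pseudo_divergent v s \<longleftrightarrow>
     (\<forall>\<nu> \<rho> \<sigma>. \<nu> < \<rho> \<and> \<rho> < \<sigma> \<longrightarrow> v (s \<rho> - s \<nu>) > v (s \<sigma> - s \<rho>))"

definition pseudo_stationary ::
    "('a::field \<Rightarrow> 'g::linordered_ab_group_add extended) \<Rightarrow> ('i::wellorder \<Rightarrow> 'a) \<Rightarrow> bool" where
  "pseudo_stationary v s \<longleftrightarrow>
     (\<forall>\<nu> \<mu> \<nu>' \<mu>'. \<nu> \<noteq> \<mu> \<and> \<nu>' \<noteq> \<mu>' \<longrightarrow> v (s \<nu> - s \<mu>) = v (s \<nu>' - s \<mu>'))"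

definition pseudo_monotone ::
    "('a::field \<Rightarrow> 'g::linordered_ab_group_add extended) \<Rightarrow> ('i::wellorder \<Rightarrow> 'a) \<Rightarrow> bool" where
  "pseudo_monotone v s \<longleftrightarrow>
     pseudo_convergent v s \<or> pseudo_divergent v s \<or> pseudo_stationary v s"

text \<open>
  The field of rational functions \<open>K(X)\<close> is \<open>'a poly fract\<close>. A point is not a pole of \<open>\<phi>\<close> iff some
  representation of \<open>\<phi>\<close> has a denominator that does not vanish there, and then every such
  representation gives the same value.
\<close>

definition is_pole_at :: "'a::field poly fract \<Rightarrow> 'a \<Rightarrow> bool" where
  "is_pole_at \<phi> a \<longleftrightarrow> \<not> (\<exists>p q. \<phi> = Fraction_Field.Fract p q \<and> poly q a \<noteq> 0)"

definition ratfun_eval :: "'a::field poly fract \<Rightarrow> 'a \<Rightarrow> 'a" where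
  "ratfun_eval \<phi> a =
     (THE y. \<exists>p q. \<phi> = Fraction_Field.Fract p q \<and> poly q a \<noteq> 0 \<and> y = poly p a / poly q a)"

lemma ratfun_eval_Fract:
  fixes p q :: "'a::field poly"
  assumes "poly q a \<noteq> 0"
  shows "\<not> is_pole_at (Fraction_Field.Fract p q) a"
    and "ratfun_eval (Fraction_Field.Fract p q) a = poly p a / poly q a"
proof -
  show "\<not> is_pole_at (Fraction_Field.Fract p q) a"
    using assms unfolding is_pole_at_def by blast
  have uniq: "poly p a / poly q a = poly p' a / poly q' a"
    if "Fraction_Field.Fract p q = Fraction_Field.Fract p' q'" "poly q' a \<noteq> 0"
    for p' q' :: "'a poly"
  proof -
    have "q \<noteq> 0" "q' \<noteq> 0" using assms that(2) by auto
    then have "p * q' = p' * q" using that(1) by (simp add: eq_fract)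
    then have "poly p a * poly q' a = poly p' a * poly q a" by (metis poly_mult)
    then show ?thesis using assms that(2) by (simp add: frac_eq_eq)
  qed
  show "ratfun_eval (Fraction_Field.Fract p q) a = poly p a / poly q a"
    unfolding ratfun_eval_def
    using assms uniq by (intro the_equality) (blast, metis)
qed

lemma is_pole_at_coprime:
  fixes p q :: "'a::field poly"
  assumes "coprime p q" "q \<noteq> 0"
  shows "is_pole_at (Fraction_Field.Fract p q) a \<longleftrightarrow> poly q a = 0"
proof
  assume "is_pole_at (Fraction_Field.Fract p q) a"
  then show "poly q a = 0" unfolding is_pole_at_def by blast
next
  assume q0: "poly q a = 0"
  show "is_pole_at (Fraction_Field.Fract p q) a"
    unfolding is_pole_at_def
  proof clarify
    fix p' q' :: "'a poly"
    assume eq: "Fraction_Field.Fract p q = Fraction_Field.Fract p' q'" and q': "poly q' a \<noteq> 0"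
    have "q' \<noteq> 0" using q' by auto
    then have "p * q' = p' * q" using eq assms(2) by (simp add: eq_fract)
    then have "poly p a * poly q' a = 0" using q0 by (metis poly_mult mult_zero_right)
    then have "poly p a = 0" using q' by simp
    then have "[:- a, 1:] dvd p" "[:- a, 1:] dvd q" using q0 by (simp_all add: poly_eq_0_iff_dvd)
    then have "is_unit [:- a, 1:]" using assms(1) by (metis coprime_common_divisor)
    then show False by (simp add: is_unit_iff_degree)
  qed
qed

end

theory Submission
  imports Defs
begin

text \<open>
  For a sequence that is not constant there are elements \<open>d\<^sub>\<nu>\<close> such that every nonzero polynomial \<open>f\<close>
  eventually satisfies \<open>v (f(s\<^sub>\<nu>)) = v (b d\<^sub>\<nu>\<^sup>k)\<close> for some \<open>b \<noteq> 0\<close> and \<open>k\<close>, where \<open>k = 0\<close> or the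
  values of \<open>d\<^sub>\<nu>\<close> are strictly monotone. Hence the sign of \<open>v (\<phi>(s\<^sub>\<nu>))\<close> is eventually constant for
  every rational function \<open>\<phi>\<close>, which is the claim (constant sequences
  are immediate). This is achieved over \<open>K\<close> itself, without
  extending \<open>v\<close> to an algebraic closure: in the pseudo-divergent case \<open>d\<^sub>\<nu> = s\<^sub>\<nu> - s\<^sub>0\<close>; in the
  pseudo-stationary case the values are eventually constant, since a primitive polynomial has only
  finitely many roots over the residue field; in the pseudo-convergent case, unless all
  polynomials have eventually constant values, \<open>d\<^sub>\<nu> = q(s\<^sub>\<nu>)\<close> for a polynomial \<open>q\<close> of least degree
  whose values are not eventually constant, and \<open>f\<close> is expanded in powers of \<open>q\<close>.
\<close>

section \<open>Eventual behaviour along a linear order without greatest element\<close>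

lemma eventually_not_in_finite:
  fixes A :: "'i::{linorder, no_top} set"
  assumes "finite A"
  shows "\<forall>\<^sub>F \<nu> in at_top. \<nu> \<notin> A"
  using assms
proof induction
  case empty
  then show ?case by simp
next
  case (insert a A)
  from insert.IH eventually_gt_at_top[of a] show ?case
    by eventually_elim auto
qed

text \<open>On the tail from \<open>N\<close>, a value above \<open>c\<close> persists. If none
  exceeds \<open>c\<close> but one equals it, then \<open>c\<close> persists; otherwise the whole
  tail lies below \<open>c\<close>.\<close>

lemma eventually_trichotomy_mono:
  fixes g :: "'i::linorder \<Rightarrow> 'b::linorder"
  assumes "\<And>\<nu> \<mu>. N \<le> \<nu> \<Longrightarrow> \<nu> < \<mu> \<Longrightarrow> g \<nu> \<le> g \<mu>"
  shows "(\<forall>\<^sub>F \<nu> in at_top. g \<nu> < c) \<or> (\<forall>\<^sub>F \<nu> in at_top. g \<nu> = c) \<or> (\<forall>\<^sub>F \<nu> in at_top. c < g \<nu>)"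
proof -
  have mono: "g \<nu> \<le> g \<mu>" if "N \<le> \<nu>" "\<nu> \<le> \<mu>" for \<nu> \<mu>
    using assms that by (cases "\<nu> = \<mu>") auto
  consider \<nu> where "N \<le> \<nu>" "c < g \<nu>" | \<nu> where "N \<le> \<nu>" "c = g \<nu>" "\<forall>\<mu>\<ge>N. g \<mu> \<le> c"
    | "\<forall>\<nu>\<ge>N. g \<nu> < c"
    by (metis linorder_cases not_less)
  then show ?thesis
  proof cases
    case 1
    then have "\<forall>\<mu>\<ge>\<nu>. c < g \<mu>" using mono by (meson order_less_le_trans)
    then show ?thesis by (auto simp: eventually_at_top_linorder)
  next
    case 2
    then have "\<forall>\<mu>\<ge>\<nu>. g \<mu> = c" using mono by (meson order.antisym order.trans)
    then show ?thesis by (auto simp: eventually_at_top_linorder)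
  qed (auto simp: eventually_at_top_linorder)
qed

lemma eventually_trichotomy_antimono:
  fixes g :: "'i::linorder \<Rightarrow> 'b::linorder"
  assumes "\<And>\<nu> \<mu>. N \<le> \<nu> \<Longrightarrow> \<nu> < \<mu> \<Longrightarrow> g \<mu> \<le> g \<nu>"
  shows "(\<forall>\<^sub>F \<nu> in at_top. g \<nu> < c) \<or> (\<forall>\<^sub>F \<nu> in at_top. g \<nu> = c) \<or> (\<forall>\<^sub>F \<nu> in at_top. c < g \<nu>)"
proof -
  have mono: "g \<mu> \<le> g \<nu>" if "N \<le> \<nu>" "\<nu> \<le> \<mu>" for \<nu> \<mu>
    using assms that by (cases "\<nu> = \<mu>") auto
  consider \<nu> where "N \<le> \<nu>" "g \<nu> < c" | \<nu> where "N \<le> \<nu>" "c = g \<nu>" "\<forall>\<mu>\<ge>N. c \<le> g \<mu>"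
    | "\<forall>\<nu>\<ge>N. c < g \<nu>"
    by (metis linorder_cases not_less)
  then show ?thesis
  proof cases
    case 1
    then have "\<forall>\<mu>\<ge>\<nu>. g \<mu> < c" using mono by (meson order_le_less_trans)
    then show ?thesis by (auto simp: eventually_at_top_linorder)
  next
    case 2
    then have "\<forall>\<mu>\<ge>\<nu>. g \<mu> = c" using mono by (meson order.antisym order.trans)
    then show ?thesis by (auto simp: eventually_at_top_linorder)
  qed (auto simp: eventually_at_top_linorder)
qed

section \<open>Valuation domains\<close>

lemma ring_of_type_algebra_simps [simp]:
  "carrier ring_of_type_algebra = UNIV"
  "x \<otimes>\<^bsub>ring_of_type_algebra\<^esub> y = x * y"
  "x \<oplus>\<^bsub>ring_of_type_algebra\<^esub> y = x + y"
  "\<one>\<^bsub>ring_of_type_algebra\<^esub> = 1"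
  "\<zero>\<^bsub>ring_of_type_algebra\<^esub> = 0"
  by (simp_all add: ring_of_type_algebra_def)

lemma a_inv_ring_of_type_algebra [simp]:
  "\<ominus>\<^bsub>ring_of_type_algebra\<^esub> x = - (x::'a::comm_ring_1)"
proof -
  interpret R: ring "ring_of_type_algebra :: 'a ring" by rule
  have "- x \<oplus>\<^bsub>ring_of_type_algebra\<^esub> x = \<zero>\<^bsub>ring_of_type_algebra\<^esub>" by simp
  then show ?thesis by (intro R.minus_equality) auto
qed

lemma valuation_domainI:
  fixes V :: "'a::field set"
  assumes "1 \<in> V" "\<And>x. x \<in> V \<Longrightarrow> - x \<in> V"
    and "\<And>x y. x \<in> V \<Longrightarrow> y \<in> V \<Longrightarrow> x * y \<in> V"
    and "\<And>x y. x \<in> V \<Longrightarrow> y \<in> V \<Longrightarrow> x + y \<in> V"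
    and "\<And>x. x \<noteq> 0 \<Longrightarrow> x \<in> V \<or> inverse x \<in> V"
  shows "valuation_domain V"
proof -
  interpret F: field "ring_of_type_algebra :: 'a ring" by rule
  have "subring V ring_of_type_algebra"
    using assms by (intro F.subringI) auto
  then have "subdomain V ring_of_type_algebra"
    by (intro F.subdomainI' F.subcringI')
  with assms(5) show ?thesis by (simp add: valuation_domain_def)
qed

lemma valuation_domainD:
  assumes "valuation_domain V"
  shows "0 \<in> V" "1 \<in> V" "x \<in> V \<Longrightarrow> - x \<in> V"
    "x \<in> V \<Longrightarrow> y \<in> V \<Longrightarrow> x * y \<in> V" "x \<in> V \<Longrightarrow> y \<in> V \<Longrightarrow> x + y \<in> V"
    "x \<noteq> 0 \<Longrightarrow> x \<in> V \<or> inverse x \<in> V"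
proof -
  have *: "subdomain V ring_of_type_algebra" using assms by (simp add: valuation_domain_def)
  from subdomainE[OF *] show "0 \<in> V" "1 \<in> V" "x \<in> V \<Longrightarrow> - x \<in> V"
    "x \<in> V \<Longrightarrow> y \<in> V \<Longrightarrow> x * y \<in> V" "x \<in> V \<Longrightarrow> y \<in> V \<Longrightarrow> x + y \<in> V" by auto
  show "x \<noteq> 0 \<Longrightarrow> x \<in> V \<or> inverse x \<in> V" using assms by (simp add: valuation_domain_def)
qed

text \<open>Of the quotients \<open>y / x\<close> and \<open>x / y\<close> one lies in
  \<open>V\<close>, so a sum of two nonunits is a multiple of one of them; hence the nonunits form
  an ideal. It is applied twice: to \<open>V\<close> in the base field and to the ring of rational
  functions.\<close>

lemma unique_maximal_ideal_nonunits:
  fixes V :: "'a::field set"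
  assumes V: "valuation_domain V"
  shows "unique_maximal_ideal {x \<in> V. x = 0 \<or> inverse x \<notin> V} V"
proof -
  let ?N = "{x \<in> V. x = 0 \<or> inverse x \<notin> V}" and ?R = "subring_of_field V"
  note D = valuation_domainD[OF V]
  interpret F: field "ring_of_type_algebra :: 'a ring" by rule
  interpret R: domain ?R
    using V F.subdomain_is_domain by (auto simp: valuation_domain_def)
  have mult: "x * y \<in> ?N" if x: "x \<in> ?N" and y: "y \<in> V" for x y
  proof -
    have "inverse x \<in> V" if "x \<noteq> 0" "y \<noteq> 0" "inverse (x * y) \<in> V"
    proof -
      have "inverse x = y * inverse (x * y)" using that by (simp add: field_simps)
      then show ?thesis using D(4)[OF y that(3)] by argo
    qed
    with x y D(4) show ?thesis by auto
  qed
  have add: "x + y \<in> ?N" if x: "x \<in> ?N" and y: "y \<in> ?N" for x y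
  proof (cases "x = 0 \<or> y = 0")
    case True
    then show ?thesis using x y by auto
  next
    case False
    have aux: "a + b \<in> ?N" if ab: "a \<in> ?N" "b / a \<in> V" "a \<noteq> 0" for a b
    proof -
      have "a + b = a * (1 + b / a)" using ab(3) by (simp add: field_simps)
      then show ?thesis using mult[OF ab(1) D(5)[OF D(2) ab(2)]] by simp
    qed
    have "y / x \<in> V \<or> x / y \<in> V" using D(6)[of "y / x"] False by (simp add: inverse_divide)
    then show ?thesis using aux[of x y] aux[of y x] x y False by (auto simp: add.commute)
  qed
  have neg: "- x \<in> ?N" if "x \<in> ?N" for x
    using mult[OF that D(3)[OF D(2)]] by simp
  have ainv: "\<ominus>\<^bsub>?R\<^esub> x = - x" if "x \<in> V" for x
  proof -
    have "- x \<oplus>\<^bsub>?R\<^esub> x = \<zero>\<^bsub>?R\<^esub>" by simp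
    then show ?thesis using that D(3) by (intro R.minus_equality) auto
  qed
  have ideal: "ideal ?N ?R"
  proof (rule idealI)
    show "subgroup ?N (add_monoid ?R)"
      using add neg D(1) ainv by (intro R.add.subgroupI) (auto simp: a_inv_def)
  qed (use mult in \<open>auto simp: mult.commute R.ring_axioms\<close>)
  \<comment> \<open>An ideal containing a unit of \<open>V\<close> contains 1 and hence all of
    \<open>V\<close>.\<close>
  have inN: "I \<subseteq> ?N" if I: "ideal I ?R" "I \<noteq> V" for I
  proof
    fix x assume x: "x \<in> I"
    interpret I: ideal I ?R by fact
    have IV: "I \<subseteq> V" using I.a_subset by simp
    show "x \<in> ?N"
    proof (rule ccontr)
      assume "x \<notin> ?N"
      then have "x \<noteq> 0" "inverse x \<in> V" using x IV by auto
      then have "1 \<in> I" using I.I_l_closed[OF x, of "inverse x"] by simp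
      then have "I = V" using I.I_l_closed[of 1] IV by auto
      with I(2) show False by simp
    qed
  qed
  have N: "?N \<subseteq> carrier ?R" "?N \<noteq> carrier ?R" using D(2) by (auto simp: set_eq_iff intro!: exI[of _ 1])
  show ?thesis
    unfolding unique_maximal_ideal_def
  proof (intro allI iffI)
    fix I assume "maximalideal I ?R"
    then interpret I: maximalideal I ?R .
    have "I \<subseteq> ?N" using inN[OF I.is_ideal] I.I_notcarr by simp
    from I.I_maximal[OF ideal this N(1)] N(2) show "I = ?N" by blast
  next
    fix I assume I: "I = ?N"
    show "maximalideal I ?R"
      unfolding I
    proof (rule maximalidealI[OF ideal])
      show "carrier ?R \<noteq> ?N" using N(2) by blast
    next
      fix J assume "ideal J ?R" "?N \<subseteq> J"
      with inN[of J] show "J = ?N \<or> J = carrier ?R" by fastforce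
    qed
  qed
qed

section \<open>Valuations\<close>

locale valued_field =
  fixes v :: "'a::field \<Rightarrow> 'g::linordered_ab_group_add extended"
  assumes valuation: "valuation v"
begin

lemma v_mult: "v (x * y) = v x + v y"
  and v_eq_infinity [simp]: "v x = \<infinity> \<longleftrightarrow> x = 0"
  and v_add_ge: "min (v x) (v y) \<le> v (x + y)"
  and v_not_Minf: "v x \<noteq> -\<infinity>"
  using valuation by (auto simp: valuation_def)

lemma v_0 [simp]: "v 0 = \<infinity>" by simp

lemma v_nonzero: assumes "x \<noteq> 0" obtains g where "v x = Fin g"
  using assms v_not_Minf[of x] v_eq_infinity[of x] by (cases "v x") auto

lemma v_less_infinity [simp]: "v x < \<infinity> \<longleftrightarrow> x \<noteq> 0"
  by (cases "x = 0") (auto elim: v_nonzero)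

lemma v_1 [simp]: "v 1 = 0"
proof -
  obtain g where "v 1 = Fin g" by (rule v_nonzero[OF one_neq_zero])
  with v_mult[of 1 1] show ?thesis by (simp add: zero_extended_def)
qed

text \<open>From (-1)(-1) = 1 twice the value of -1 is 0, and an ordered abelian group has no
  element of order two.\<close>

lemma v_minus [simp]: "v (- x) = v x"
proof -
  obtain g where g: "v (-1) = Fin g" by (rule v_nonzero[of "-1"]) simp
  with v_mult[of "-1" "-1"] have "g + g = 0" by (simp add: zero_extended_def)
  then have "v (-1) = 0" using g by (simp add: zero_extended_def)
  with v_mult[of "-1" x] show ?thesis by simp
qed

lemma v_mult_mono: "v a \<le> v b \<Longrightarrow> v c \<le> v d \<Longrightarrow> v (a * c) \<le> v (b * d)"
  by (simp add: v_mult add_mono)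

lemma v_mult_strict_right:
  assumes "v a < v b" "z \<noteq> 0"
  shows "v (a * z) < v (b * z)"
proof -
  obtain g where "v z = Fin g" by (rule v_nonzero[OF assms(2)])
  then show ?thesis using assms(1) v_not_Minf[of a] v_not_Minf[of b]
    by (cases "v a"; cases "v b") (auto simp: v_mult)
qed

lemma v_mult_strict_mono:
  assumes "v a < v b" "v c \<le> v d" "c \<noteq> 0"
  shows "v (a * c) < v (b * d)"
  using v_mult_strict_right[OF assms(1,3)] v_mult_mono[OF order.refl assms(2), of b]
  by (rule order_less_le_trans)

lemma v_mult_cancel:
  assumes "z \<noteq> 0"
  shows "v (a * z) \<le> v (b * z) \<longleftrightarrow> v a \<le> v b"
  using v_mult_strict_right[OF _ assms, of b a] v_mult_mono[of a b z z] by (auto simp: not_less[symmetric])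

lemma v_power_mono: "v a \<le> v b \<Longrightarrow> v (a ^ n) \<le> v (b ^ n)"
  by (induction n) (simp_all add: v_mult_mono)

lemma v_power_strict_mono:
  assumes "v a < v b" "a \<noteq> 0" "0 < n"
  shows "v (a ^ n) < v (b ^ n)"
  using v_mult_strict_mono[OF assms(1) v_power_mono[OF less_imp_le[OF assms(1)], of "n - 1"]] assms(2,3)
  by (cases n) simp_all

lemma v_mult_cong: "v a = v b \<Longrightarrow> v c = v d \<Longrightarrow> v (a * c) = v (b * d)"
  by (simp add: v_mult)

lemma v_power_cong: "v a = v b \<Longrightarrow> v (a ^ n) = v (b ^ n)"
  by (induction n) (simp_all add: v_mult)

lemma v_divide_iff:
  assumes "y \<noteq> 0"
  shows "0 \<le> v (x / y) \<longleftrightarrow> v y \<le> v x" "0 < v (x / y) \<longleftrightarrow> v y < v x"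
    "v (x / y) = 0 \<longleftrightarrow> v x = v y"
proof -
  \<comment> \<open>Reading 0 as \<open>v 1\<close> and scaling by \<open>y\<close> turns the sign
    of the quotient into a comparison, without subtraction in the extended group.\<close>
  have "v 1 \<le> v (x / y) \<longleftrightarrow> v (1 * y) \<le> v (x / y * y)"
    "v (x / y) \<le> v 1 \<longleftrightarrow> v (x / y * y) \<le> v (1 * y)"
    by (rule v_mult_cancel[OF assms, symmetric])+
  then have "0 \<le> v (x / y) \<longleftrightarrow> v y \<le> v x" "v (x / y) \<le> 0 \<longleftrightarrow> v x \<le> v y"
    using assms by simp_all
  then show "0 \<le> v (x / y) \<longleftrightarrow> v y \<le> v x" "0 < v (x / y) \<longleftrightarrow> v y < v x"
    "v (x / y) = 0 \<longleftrightarrow> v x = v y"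
    by (auto simp: not_le[symmetric])
qed

text \<open>If \<open>a + b\<close> had larger value than \<open>a\<close>, then a = (a + b) + (-b)
  would be a sum of two terms of value greater than \<open>v a\<close>.\<close>

lemma v_add_eq: "v (a + b) = v a" if "v a < v b"
proof (rule order.antisym)
  show "v a \<le> v (a + b)" using v_add_ge[of a b] that by simp
  have "min (v (a + b)) (v b) \<le> v a" using v_add_ge[of "a + b" "- b"] by simp
  then show "v (a + b) \<le> v a" using that by (auto simp: min_le_iff_disj)
qed

text \<open>The bound must be below infinity because of the empty sum, whose value is
  infinity.\<close>

lemma v_sum_greater:
  assumes "g < \<infinity>" "\<And>i. i \<in> A \<Longrightarrow> g < v (f i)"
  shows "g < v (sum f A)"
  using assms
proof (induction A rule: infinite_finite_induct)
  case (insert i A)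
  then have "g < min (v (f i)) (v (sum f A))" by simp
  also have "\<dots> \<le> v (f i + sum f A)" by (rule v_add_ge)
  finally show ?case using insert by simp
qed auto

lemma v_sum_ge:
  assumes "\<And>i. i \<in> A \<Longrightarrow> g \<le> v (f i)"
  shows "g \<le> v (sum f A)"
  using assms
proof (induction A rule: infinite_finite_induct)
  case (insert i A)
  then have "g \<le> min (v (f i)) (v (sum f A))" by simp
  also have "\<dots> \<le> v (f i + sum f A)" by (rule v_add_ge)
  finally show ?case using insert by simp
qed auto

lemma v_sum_dominant:
  assumes "finite A" "j \<in> A" "f j \<noteq> 0" "\<And>i. i \<in> A - {j} \<Longrightarrow> v (f j) < v (f i)"
  shows "v (sum f A) = v (f j)"
proof -
  have "v (f j) < v (sum f (A - {j}))"
    using assms by (intro v_sum_greater) auto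
  from v_add_eq[OF this] show ?thesis using assms(1,2) by (simp add: sum.remove)
qed

end

text \<open>The \<open>F i\<close> are the Hasse derivatives of \<open>f\<close>; iterated derivatives divided by factorials would
  not do in positive characteristic.\<close>

lemma taylor_poly:
  fixes f :: "'a::comm_ring_1 poly"
  assumes "degree f \<le> n"
  obtains F where "F 0 = f" "\<And>i. degree (F i) \<le> n - i"
    "\<And>x y. poly f (x + y) = (\<Sum>i\<le>n. poly (F i) x * y ^ i)"
proof -
  \<comment> \<open>Truncated subtraction would still allow constants \<open>F i\<close> for i > n,
    so their vanishing is carried through the induction; it lets the sum be lengthened by a zero
    term.\<close>
  have "\<exists>F. F 0 = f \<and> (\<forall>i. degree (F i) \<le> n - i) \<and> (\<forall>i>n. F i = 0) \<and>
    (\<forall>x y. poly f (x + y) = (\<Sum>i\<le>n. poly (F i) x * y ^ i))"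
    using assms
  proof (induction n arbitrary: f)
    case 0
    then obtain a where "f = [:a:]" by (metis degree_eq_zeroE le_zero_eq)
    then show ?case by (intro exI[of _ "\<lambda>i. if i = 0 then f else 0"]) auto
  next
    case (Suc n)
    obtain a g where f: "f = pCons a g" by (rule pCons_cases)
    have "degree g \<le> n" using Suc.prems unfolding f by (cases "g = 0") auto
    then obtain F where F: "F 0 = g" "\<And>i. degree (F i) \<le> n - i" "\<And>i. i > n \<Longrightarrow> F i = 0"
      "\<And>x y. poly g (x + y) = (\<Sum>i\<le>n. poly (F i) x * y ^ i)"
      using Suc.IH by blast
    \<comment> \<open>With f = a + X g one has f(x + y) = a + (x + y) g(x + y), whose coefficient at
      y^i for i > 0 is x F_i(x) + F_{i-1}(x).\<close>
    define G where "G i = (if i = 0 then f else [:0, 1:] * F i + F (i - 1))" for i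
    have "degree (G i) \<le> Suc n - i" for i
    proof (cases "i = 0")
      case True
      then show ?thesis using Suc.prems by (simp add: G_def)
    next
      case False
      have "degree ([:0, 1:] * F i) \<le> Suc n - i"
      proof (cases "i \<le> n")
        case True
        then show ?thesis using F(2)[of i] by (cases "F i = 0") auto
      next
        case False
        then show ?thesis using F(3)[of i] by simp
      qed
      moreover have "degree (F (i - 1)) \<le> Suc n - i" using F(2)[of "i - 1"] False by simp
      ultimately show ?thesis using False by (simp add: G_def degree_add_le)
    qed
    moreover have "G i = 0" if "i > Suc n" for i using that F(3) by (simp add: G_def)
    moreover have "poly f (x + y) = (\<Sum>i\<le>Suc n. poly (G i) x * y ^ i)" for x y
    proof -
      have "(\<Sum>i\<le>n. poly (F i) x * y ^ i) = (\<Sum>i\<le>Suc n. poly (F i) x * y ^ i)"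
        using F(3) by simp
      also have "\<dots> = poly g x + (\<Sum>i\<le>n. poly (F (Suc i)) x * y ^ Suc i)"
        by (simp only: sum.atMost_Suc_shift) (simp add: F(1))
      finally have "poly g (x + y) = poly g x + (\<Sum>i\<le>n. poly (F (Suc i)) x * y ^ Suc i)"
        using F(4) by simp
      moreover have "y * poly g (x + y) = (\<Sum>i\<le>n. poly (F i) x * y ^ Suc i)"
        by (simp add: F(4) sum_distrib_left mult_ac)
      moreover have "poly f (x + y) = a + x * poly g (x + y) + y * poly g (x + y)"
        by (simp add: f algebra_simps)
      ultimately have "poly f (x + y) = poly f x +
          (\<Sum>i\<le>n. (x * poly (F (Suc i)) x + poly (F i) x) * y ^ Suc i)"
        by (simp add: f algebra_simps sum.distrib sum_distrib_left)
      also have "\<dots> = (\<Sum>i\<le>Suc n. poly (G i) x * y ^ i)"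
        by (simp only: sum.atMost_Suc_shift) (simp add: G_def)
      finally show ?thesis .
    qed
    moreover have "G 0 = f" by (simp add: G_def)
    ultimately show ?case by blast
  qed
  then show ?thesis using that by blast
qed

text \<open>Base \<open>q\<close> digits by repeated division: the remainder is digit 0 and the
  digits of the quotient move up one place. Division lowers the degree since \<open>q\<close> is not
  constant.\<close>

lemma poly_adic_expansion:
  fixes f q :: "'a::field poly"
  assumes "0 < degree q"
  obtains r n where "\<And>i. degree (r i) < degree q" "f = (\<Sum>i\<le>n. r i * q ^ i)"
proof -
  have "\<exists>r n. (\<forall>i. degree (r i) < degree q) \<and> f = (\<Sum>i\<le>(n::nat). r i * q ^ i)"
  proof (induction "degree f" arbitrary: f rule: less_induct)
    case less
    show ?case
    proof (cases "degree f < degree q")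
      case True
      \<comment> \<open>Only digit 0 is summed; the constant family keeps the degree bound at every
        index.\<close>
      then show ?thesis by (intro exI[of _ "\<lambda>_. f"] exI[of _ 0]) simp
    next
      case False
      have q: "q \<noteq> 0" using assms by auto
      have fq: "f = f div q * q + f mod q" by simp
      have "degree (f div q) < degree f" using assms False by (simp add: Polynomial.degree_div_less)
      then obtain r n where r: "\<And>i. degree (r i) < degree q" "f div q = (\<Sum>i\<le>n. r i * q ^ i)"
        using less by blast
      define R where "R i = (case i of 0 \<Rightarrow> f mod q | Suc j \<Rightarrow> r j)" for i
      have "degree (f mod q) < degree q" using degree_mod_less[OF q, of f] assms by auto
      then have "degree (R i) < degree q" for i using r(1) by (cases i) (auto simp: R_def)
      moreover have "f = (\<Sum>i\<le>Suc n. R i * q ^ i)"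
      proof -
        have "(\<Sum>i\<le>Suc n. R i * q ^ i) = f mod q + (\<Sum>i\<le>n. r i * q ^ i) * q"
          by (simp only: sum.atMost_Suc_shift) (simp add: R_def sum_distrib_left sum_distrib_right mult_ac)
        then show ?thesis using fq unfolding r(2)[symmetric] by (simp only: add.commute)
      qed
      ultimately show ?thesis by blast
    qed
  qed
  then show ?thesis using that by blast
qed

section \<open>Comparing monomials along a sequence with strictly monotone values\<close>

context valued_field
begin

definition strict_values :: "('i::linorder \<Rightarrow> 'a) \<Rightarrow> bool" where
  "strict_values d \<longleftrightarrow> (\<exists>N. (\<forall>\<nu>\<ge>N. d \<nu> \<noteq> 0) \<and>
     ((\<forall>\<nu>\<ge>N. \<forall>\<mu>>\<nu>. v (d \<nu>) < v (d \<mu>)) \<or> (\<forall>\<nu>\<ge>N. \<forall>\<mu>>\<nu>. v (d \<mu>) < v (d \<nu>))))"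

lemma strict_values_nonzero: "strict_values d \<Longrightarrow> \<forall>\<^sub>F \<nu> in at_top. d \<nu> \<noteq> 0"
  by (auto simp: strict_values_def eventually_at_top_linorder)

lemma monomial_nonzero:
  assumes "k = 0 \<or> strict_values d" "c \<noteq> 0"
  shows "\<forall>\<^sub>F \<nu> in at_top. c * d \<nu> ^ k \<noteq> 0"
  using assms(1)
proof
  assume "strict_values d"
  from strict_values_nonzero[OF this] show ?thesis
    by eventually_elim (use assms in auto)
qed (use assms in auto)

lemma monomial_trichotomy:
  assumes "k = 0 \<or> strict_values d"
  shows "(\<forall>\<^sub>F \<nu> in at_top. v (c * d \<nu> ^ k) < C) \<or> (\<forall>\<^sub>F \<nu> in at_top. v (c * d \<nu> ^ k) = C) \<or>
    (\<forall>\<^sub>F \<nu> in at_top. C < v (c * d \<nu> ^ k))"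
  using assms
proof
  assume "k = 0"
  then show ?thesis using linorder_less_linear[of "v c" C] by auto
next
  assume "strict_values d"
  then consider N where "\<And>\<nu> \<mu>. N \<le> \<nu> \<Longrightarrow> \<nu> < \<mu> \<Longrightarrow> v (d \<nu>) \<le> v (d \<mu>)"
    | N where "\<And>\<nu> \<mu>. N \<le> \<nu> \<Longrightarrow> \<nu> < \<mu> \<Longrightarrow> v (d \<mu>) \<le> v (d \<nu>)"
    unfolding strict_values_def by (meson less_imp_le)
  then show ?thesis
  proof cases
    case 1
    then show ?thesis
      by (intro eventually_trichotomy_mono[where N = N]) (simp add: v_mult_mono v_power_mono)
  next
    case 2
    then show ?thesis
      by (intro eventually_trichotomy_antimono[where N = N]) (simp add: v_mult_mono v_power_mono)
  qed
qed

text \<open>For a positive exponent the values on a tail are pairwise distinct, so the middle case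
  of \<open>monomial_trichotomy\<close> cannot occur.\<close>

lemma monomial_dichotomy:
  fixes d :: "'i::{linorder, no_top} \<Rightarrow> 'a"
  assumes "strict_values d" "c \<noteq> 0" "0 < k"
  shows "(\<forall>\<^sub>F \<nu> in at_top. v (c * d \<nu> ^ k) < C) \<or> (\<forall>\<^sub>F \<nu> in at_top. C < v (c * d \<nu> ^ k))"
proof -
  have "\<not> (\<forall>\<^sub>F \<nu> in at_top. v (c * d \<nu> ^ k) = C)"
  proof
    assume "\<forall>\<^sub>F \<nu> in at_top. v (c * d \<nu> ^ k) = C"
    then obtain N where N: "\<And>\<nu>. N \<le> \<nu> \<Longrightarrow> v (c * d \<nu> ^ k) = C"
      by (auto simp: eventually_at_top_linorder)
    from assms(1) obtain L where L: "\<And>\<nu>. L \<le> \<nu> \<Longrightarrow> d \<nu> \<noteq> 0"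
      "\<And>\<nu> \<mu>. L \<le> \<nu> \<Longrightarrow> \<nu> < \<mu> \<Longrightarrow> v (d \<nu>) \<noteq> v (d \<mu>)"
      unfolding strict_values_def by (metis order_less_irrefl)
    obtain \<mu> where \<mu>: "max N L < \<mu>" using gt_ex by blast
    have neq: "v (c * a ^ k) < v (c * b ^ k)" if "v a < v b" "a \<noteq> 0" for a b
      using v_power_strict_mono[OF that assms(3)] v_mult_strict_right[of "a ^ k" "b ^ k" c] assms
      by (simp add: mult.commute)
    let ?\<nu> = "max N L"
    have d: "d ?\<nu> \<noteq> 0" "d \<mu> \<noteq> 0" and eq: "v (c * d ?\<nu> ^ k) = v (c * d \<mu> ^ k)"
      using L(1) N[of ?\<nu>] N[of \<mu>] \<mu> by auto
    have "v (d ?\<nu>) \<noteq> v (d \<mu>)" using L(2) \<mu> by simp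
    then show False
      using neq[OF _ d(1)] neq[OF _ d(2)] eq by (metis linorder_cases order_less_irrefl)
  qed
  with monomial_trichotomy[of k d c C] assms show ?thesis by blast
qed

text \<open>Cancelling the monomial of smaller exponent reduces a comparison of two monomials to the
  sign of a single one.\<close>

lemma monomial_compare_aux:
  assumes "k' \<le> k" "c' \<noteq> 0" "z \<noteq> 0"
  shows "v (c * z ^ k) < v (c' * z ^ k') \<longleftrightarrow> v (c / c' * z ^ (k - k')) < 0"
    and "v (c' * z ^ k') < v (c * z ^ k) \<longleftrightarrow> 0 < v (c / c' * z ^ (k - k'))"
proof -
  have z: "c' * z ^ k' \<noteq> 0" using assms by simp
  have "c * z ^ k = (c / c' * z ^ (k - k')) * (c' * z ^ k')"
    using assms by (simp add: power_add[symmetric])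
  moreover have "c' * z ^ k' = 1 * (c' * z ^ k')" by simp
  ultimately have "v (c * z ^ k) \<le> v (c' * z ^ k') \<longleftrightarrow> v (c / c' * z ^ (k - k')) \<le> v 1"
    "v (c' * z ^ k') \<le> v (c * z ^ k) \<longleftrightarrow> v 1 \<le> v (c / c' * z ^ (k - k'))"
    using v_mult_cancel[OF z] by metis+
  then show "v (c * z ^ k) < v (c' * z ^ k') \<longleftrightarrow> v (c / c' * z ^ (k - k')) < 0"
    "v (c' * z ^ k') < v (c * z ^ k) \<longleftrightarrow> 0 < v (c / c' * z ^ (k - k'))"
    by (auto simp: not_le[symmetric])
qed

lemma monomial_compare:
  assumes "k = 0 \<or> strict_values d" "k' = 0 \<or> strict_values d" "c \<noteq> 0" "c' \<noteq> 0"
  shows "(\<forall>\<^sub>F \<nu> in at_top. v (c * d \<nu> ^ k) < v (c' * d \<nu> ^ k')) \<or>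
    (\<forall>\<^sub>F \<nu> in at_top. v (c * d \<nu> ^ k) = v (c' * d \<nu> ^ k')) \<or>
    (\<forall>\<^sub>F \<nu> in at_top. v (c' * d \<nu> ^ k') < v (c * d \<nu> ^ k))"
proof (cases "strict_values d")
  case True
  have le: "(\<forall>\<^sub>F \<nu> in at_top. v (c * d \<nu> ^ k) < v (c' * d \<nu> ^ k')) \<or>
    (\<forall>\<^sub>F \<nu> in at_top. v (c * d \<nu> ^ k) = v (c' * d \<nu> ^ k')) \<or>
    (\<forall>\<^sub>F \<nu> in at_top. v (c' * d \<nu> ^ k') < v (c * d \<nu> ^ k))"
    if "k' \<le> k" "c' \<noteq> 0" for k k' c c'
  proof -
    note aux = monomial_compare_aux[OF that]
    note nz = strict_values_nonzero[OF True]
    consider "\<forall>\<^sub>F \<nu> in at_top. v (c / c' * d \<nu> ^ (k - k')) < 0"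
      | "\<forall>\<^sub>F \<nu> in at_top. v (c / c' * d \<nu> ^ (k - k')) = 0"
      | "\<forall>\<^sub>F \<nu> in at_top. 0 < v (c / c' * d \<nu> ^ (k - k'))"
      using monomial_trichotomy[of "k - k'" d] True by blast
    then show ?thesis
    proof cases
      case 1
      with nz have "\<forall>\<^sub>F \<nu> in at_top. v (c * d \<nu> ^ k) < v (c' * d \<nu> ^ k')"
        by eventually_elim (simp add: aux)
      then show ?thesis by simp
    next
      case 2
      with nz have "\<forall>\<^sub>F \<nu> in at_top. v (c * d \<nu> ^ k) = v (c' * d \<nu> ^ k')"
        by eventually_elim (metis aux linorder_cases order_less_irrefl)
      then show ?thesis by simp
    next
      case 3
      with nz have "\<forall>\<^sub>F \<nu> in at_top. v (c' * d \<nu> ^ k') < v (c * d \<nu> ^ k)"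
        by eventually_elim (simp add: aux)
      then show ?thesis by simp
    qed
  qed
  show ?thesis
  proof (cases "k' \<le> k")
    case True
    then show ?thesis using le assms by simp
  next
    case False
    then have "k \<le> k'" by simp
    from le[OF this assms(3), of c'] show ?thesis by (simp add: eq_commute disj_ac)
  qed
next
  case False
  \<comment> \<open>Without strict values both exponents are 0 and two constants are
    compared.\<close>
  then show ?thesis using assms(1,2) linorder_less_linear[of "v c" "v c'"] by auto
qed

lemma monomial_compare_strict:
  fixes d :: "'i::{linorder, no_top} \<Rightarrow> 'a"
  assumes "strict_values d" "k \<noteq> k'" "c \<noteq> 0" "c' \<noteq> 0"
  shows "(\<forall>\<^sub>F \<nu> in at_top. v (c * d \<nu> ^ k) < v (c' * d \<nu> ^ k')) \<or>
    (\<forall>\<^sub>F \<nu> in at_top. v (c' * d \<nu> ^ k') < v (c * d \<nu> ^ k))"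
proof -
  have less: "(\<forall>\<^sub>F \<nu> in at_top. v (c * d \<nu> ^ k) < v (c' * d \<nu> ^ k')) \<or>
    (\<forall>\<^sub>F \<nu> in at_top. v (c' * d \<nu> ^ k') < v (c * d \<nu> ^ k))"
    if less: "k' < k" and nonzero: "c \<noteq> 0" "c' \<noteq> 0" for k k' c c'
  proof -
    note aux = monomial_compare_aux[OF less_imp_le[OF less] nonzero(2)]
    note nz = strict_values_nonzero[OF assms(1)]
    consider "\<forall>\<^sub>F \<nu> in at_top. v (c / c' * d \<nu> ^ (k - k')) < 0"
      | "\<forall>\<^sub>F \<nu> in at_top. 0 < v (c / c' * d \<nu> ^ (k - k'))"
    proof -
      have "c / c' \<noteq> 0" "0 < k - k'" using less nonzero by simp_all
      from monomial_dichotomy[OF assms(1) this, of 0] show thesis using that by blast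
    qed
    then show ?thesis
    proof cases
      case 1
      with nz have "\<forall>\<^sub>F \<nu> in at_top. v (c * d \<nu> ^ k) < v (c' * d \<nu> ^ k')"
        by eventually_elim (simp add: aux)
      then show ?thesis by simp
    next
      case 2
      with nz have "\<forall>\<^sub>F \<nu> in at_top. v (c' * d \<nu> ^ k') < v (c * d \<nu> ^ k)"
        by eventually_elim (simp add: aux)
      then show ?thesis by simp
    qed
  qed
  show ?thesis using less[of k' k c c'] less[of k k' c' c] assms by (cases "k' < k") auto
qed

text \<open>Monomials with distinct exponents and nonzero coefficients are eventually strictly
  comparable, and zero coefficients give value infinity. So finitely many of them have a unique
  eventual minimum, which then determines the value of their sum.\<close>

lemma monomial_dominant:
  fixes d :: "'i::{linorder, no_top} \<Rightarrow> 'a"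
  assumes "strict_values d" "finite A" "\<exists>j\<in>A. \<alpha> j \<noteq> 0"
  obtains j where "j \<in> A" "\<alpha> j \<noteq> 0"
    "\<forall>\<^sub>F \<nu> in at_top. \<forall>i\<in>A - {j}. v (\<alpha> j * d \<nu> ^ j) < v (\<alpha> i * d \<nu> ^ i)"
proof -
  have "\<exists>j\<in>A. \<alpha> j \<noteq> 0 \<and>
      (\<forall>\<^sub>F \<nu> in at_top. \<forall>i\<in>A - {j}. v (\<alpha> j * d \<nu> ^ j) < v (\<alpha> i * d \<nu> ^ i))"
    using assms(2,3)
  proof (induction A)
    case (insert i A)
    note nz = strict_values_nonzero[OF assms(1)]
    show ?case
    proof (cases "\<exists>j\<in>A. \<alpha> j \<noteq> 0")
      case False
      then have "\<alpha> i \<noteq> 0" "\<forall>j\<in>A. \<alpha> j = 0" using insert.prems by auto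
      moreover from this have "\<forall>\<^sub>F \<nu> in at_top. \<forall>j\<in>insert i A - {i}. v (\<alpha> i * d \<nu> ^ i) < v (\<alpha> j * d \<nu> ^ j)"
        
        by (intro eventually_mono[OF nz]) auto
      ultimately show ?thesis by blast
    next
      case True
      then obtain j where j: "j \<in> A" "\<alpha> j \<noteq> 0"
        "\<forall>\<^sub>F \<nu> in at_top. \<forall>k\<in>A - {j}. v (\<alpha> j * d \<nu> ^ j) < v (\<alpha> k * d \<nu> ^ k)"
        using insert.IH by blast
      show ?thesis
      proof (cases "\<alpha> i = 0")
        case True
        have "\<forall>\<^sub>F \<nu> in at_top. \<forall>k\<in>insert i A - {j}. v (\<alpha> j * d \<nu> ^ j) < v (\<alpha> k * d \<nu> ^ k)"
          using nz j(3) by eventually_elim (use True j in auto)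
        then show ?thesis using j by blast
      next
        case False
        have "i \<noteq> j" using j(1) insert.hyps by auto
        from monomial_compare_strict[OF assms(1) this False j(2)] show ?thesis
        proof
          assume "\<forall>\<^sub>F \<nu> in at_top. v (\<alpha> i * d \<nu> ^ i) < v (\<alpha> j * d \<nu> ^ j)"
          with j(3) have "\<forall>\<^sub>F \<nu> in at_top. \<forall>k\<in>insert i A - {i}. v (\<alpha> i * d \<nu> ^ i) < v (\<alpha> k * d \<nu> ^ k)"
          proof eventually_elim
            case (elim \<nu>)
            show ?case
            proof
              fix k assume "k \<in> insert i A - {i}"
              then show "v (\<alpha> i * d \<nu> ^ i) < v (\<alpha> k * d \<nu> ^ k)"
                using elim order_less_trans by (cases "k = j") blast+
            qed
          qed
          then show ?thesis using False by blast
        next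
          assume "\<forall>\<^sub>F \<nu> in at_top. v (\<alpha> j * d \<nu> ^ j) < v (\<alpha> i * d \<nu> ^ i)"
          with j(3) have "\<forall>\<^sub>F \<nu> in at_top. \<forall>k\<in>insert i A - {j}. v (\<alpha> j * d \<nu> ^ j) < v (\<alpha> k * d \<nu> ^ k)"
            by eventually_elim blast
          then show ?thesis using j by blast
        qed
      qed
    qed
  qed simp
  then show ?thesis using that by blast
qed

section \<open>Values of polynomials along a sequence\<close>

text \<open>Each of the finitely many roots is met at most once on the tail where \<open>s\<close>
  is injective.\<close>

lemma poly_eventually_nonzero:
  fixes s :: "'i::{linorder, no_top} \<Rightarrow> 'a"
  assumes "inj_on s {N..}" "f \<noteq> 0"
  shows "\<forall>\<^sub>F \<nu> in at_top. poly f (s \<nu>) \<noteq> 0"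
proof -
  let ?A = "{\<nu>\<in>{N..}. poly f (s \<nu>) = 0}"
  have "finite (s ` ?A)"
    by (rule finite_subset[OF _ poly_roots_finite[OF assms(2)]]) auto
  moreover have "inj_on s ?A" using assms(1) by (rule inj_on_subset) auto
  ultimately have "finite ?A" by (simp add: finite_image_iff)
  from eventually_not_in_finite[OF this] eventually_ge_at_top[of N] show ?thesis
    by eventually_elim auto
qed

text \<open>The scale \<open>d\<close> is common to all polynomials, so that numerator and
  denominator of a rational function can be compared. The alternative \<open>k = 0\<close> covers
  eventually constant values and then asks nothing of \<open>d\<close>.\<close>

definition monomial_values :: "('i::linorder \<Rightarrow> 'a) \<Rightarrow> ('i \<Rightarrow> 'a) \<Rightarrow> bool" where
  "monomial_values s d \<longleftrightarrow> (\<forall>f. f \<noteq> 0 \<longrightarrow> (\<exists>b k. b \<noteq> 0 \<and> (k = 0 \<or> strict_values d) \<and>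
     (\<forall>\<^sub>F \<nu> in at_top. v (poly f (s \<nu>)) = v (b * d \<nu> ^ k))))"

text \<open>The limit value is given through a field element \<open>c\<close>, which can later serve
  as a coefficient of a monomial; \<open>c = 0\<close> accounts for the zero polynomial.\<close>

definition constant_value :: "('i::linorder \<Rightarrow> 'a) \<Rightarrow> 'a poly \<Rightarrow> bool" where
  "constant_value s f \<longleftrightarrow> (\<exists>c. \<forall>\<^sub>F \<nu> in at_top. v (poly f (s \<nu>)) = v c)"

lemma monomial_values_constant:
  fixes s :: "'i::{linorder, no_top} \<Rightarrow> 'a"
  assumes "inj_on s {N..}" "\<And>f. constant_value s f"
  shows "monomial_values s d"
  unfolding monomial_values_def
proof (intro allI impI)
  fix f :: "'a poly" assume "f \<noteq> 0"
  obtain c where c: "\<forall>\<^sub>F \<nu> in at_top. v (poly f (s \<nu>)) = v c"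
    using assms(2)[of f] by (auto simp: constant_value_def)
  have "\<forall>\<^sub>F \<nu> in at_top::'i filter. c \<noteq> 0"
    using c poly_eventually_nonzero[OF assms(1) \<open>f \<noteq> 0\<close>] by eventually_elim auto
  then have "c \<noteq> 0" by simp
  with c show "\<exists>b k. b \<noteq> 0 \<and> (k = 0 \<or> strict_values d) \<and>
     (\<forall>\<^sub>F \<nu> in at_top. v (poly f (s \<nu>)) = v (b * d \<nu> ^ k))"
    by (intro exI[of _ c] exI[of _ 0]) simp
qed

text \<open>In base \<open>q\<close> the digits of \<open>f\<close> have eventually constant values,
  so the terms of the expansion have the values of monomials in \<open>q(s)\<close>, among which one
  dominates.\<close>

lemma monomial_values_adic:
  fixes s :: "'i::{linorder, no_top} \<Rightarrow> 'a"
  assumes inj: "inj_on s {N..}" and q: "0 < degree q"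
    and strict: "strict_values (\<lambda>\<nu>. poly q (s \<nu>))"
    and const: "\<And>r. degree r < degree q \<Longrightarrow> constant_value s r"
  shows "monomial_values s (\<lambda>\<nu>. poly q (s \<nu>))"
  unfolding monomial_values_def
proof (intro allI impI)
  fix f :: "'a poly" assume f: "f \<noteq> 0"
  define y where "y \<nu> = poly q (s \<nu>)" for \<nu>
  have y: "strict_values y" using strict by (simp add: y_def[abs_def])
  obtain r n where r: "\<And>i. degree (r i) < degree q" and fr: "f = (\<Sum>i\<le>n. r i * q ^ i)"
    using poly_adic_expansion[OF q, of f] by blast
  have "\<exists>\<alpha>. \<forall>i. \<forall>\<^sub>F \<nu> in at_top. v (poly (r i) (s \<nu>)) = v (\<alpha> i)"
    using const[OF r] unfolding constant_value_def by metis
  then obtain \<alpha> where \<alpha>: "\<And>i. \<forall>\<^sub>F \<nu> in at_top. v (poly (r i) (s \<nu>)) = v (\<alpha> i)" by blast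
  have \<alpha>_all: "\<forall>\<^sub>F \<nu> in at_top. \<forall>i\<in>{..n}. v (poly (r i) (s \<nu>)) = v (\<alpha> i)"
    using \<alpha> by (intro eventually_ball_finite) auto
  have poly_f: "poly f (s \<nu>) = (\<Sum>i\<le>n. poly (r i) (s \<nu>) * y \<nu> ^ i)" for \<nu>
    by (simp add: fr poly_sum y_def)
  \<comment> \<open>Otherwise all digits, and with them \<open>f\<close>, would vanish on a
    tail.\<close>
  have "\<exists>j\<in>{..n}. \<alpha> j \<noteq> 0"
  proof (rule ccontr)
    assume zero: "\<not> (\<exists>j\<in>{..n}. \<alpha> j \<noteq> 0)"
    have "\<forall>\<^sub>F \<nu> in at_top::'i filter. False"
      using \<alpha>_all poly_eventually_nonzero[OF inj f]
    proof eventually_elim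
      case (elim \<nu>)
      then have "poly (r i) (s \<nu>) = 0" if "i \<le> n" for i using zero that by fastforce
      then show ?case using elim poly_f[of \<nu>] by simp
    qed
    then show False by simp
  qed
  from monomial_dominant[OF y _ this] obtain j where j: "j \<in> {..n}" "\<alpha> j \<noteq> 0"
    and dom: "\<forall>\<^sub>F \<nu> in at_top. \<forall>i\<in>{..n} - {j}. v (\<alpha> j * y \<nu> ^ j) < v (\<alpha> i * y \<nu> ^ i)"
    by blast
  have "\<forall>\<^sub>F \<nu> in at_top. v (poly f (s \<nu>)) = v (\<alpha> j * y \<nu> ^ j)"
    using \<alpha>_all dom strict_values_nonzero[OF y]
  proof eventually_elim
    case (elim \<nu>)
    have eq: "v (poly (r i) (s \<nu>) * y \<nu> ^ i) = v (\<alpha> i * y \<nu> ^ i)" if "i \<le> n" for i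
      using elim(1) that by (simp add: v_mult)
    have "\<alpha> j * y \<nu> ^ j \<noteq> 0" using j(2) elim(3) by simp
    then have nz: "poly (r j) (s \<nu>) * y \<nu> ^ j \<noteq> 0"
      using eq[of j] j(1) v_eq_infinity by (metis atMost_iff)
    have "v (poly f (s \<nu>)) = v (poly (r j) (s \<nu>) * y \<nu> ^ j)"
      unfolding poly_f using elim(2) eq j(1) nz
      by (intro v_sum_dominant[where f = "\<lambda>i. poly (r i) (s \<nu>) * y \<nu> ^ i"]) auto
    with eq[of j] j(1) show ?case by simp
  qed
  with j(2) y show "\<exists>b k. b \<noteq> 0 \<and> (k = 0 \<or> strict_values (\<lambda>\<nu>. poly q (s \<nu>))) \<and>
     (\<forall>\<^sub>F \<nu> in at_top. v (poly f (s \<nu>)) = v (b * poly q (s \<nu>) ^ k))"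
    unfolding y_def[abs_def] by blast
qed

lemma constant_value_degree_0: "degree r = 0 \<Longrightarrow> constant_value s r"
  by (auto simp: constant_value_def elim!: degree_eq_zeroE)

section \<open>The three kinds of pseudo-monotone sequences\<close>

lemma monomial_values_pseudo_divergent:
  fixes s :: "'i::{wellorder, no_top} \<Rightarrow> 'a"
  assumes "pseudo_divergent v s"
  shows "\<exists>d. monomial_values s d"
proof -
  have div: "v (s \<sigma> - s \<rho>) < v (s \<rho> - s \<nu>)" if "\<nu> < \<rho>" "\<rho> < \<sigma>" for \<nu> \<rho> \<sigma>
    using assms that by (auto simp: pseudo_divergent_def)
  obtain o1 o2 :: 'i where o2: "o1 < o2" using gt_ex by blast
  define a where "a = s o1"
  \<comment> \<open>In (s \<sigma> - s \<rho>) + (s \<rho> - a) the first summand has the smaller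
    value. Hence X - a takes strictly decreasing values, and its base expansion has constant
    digits.\<close>
  have less: "v (s \<sigma> - a) < v (s \<rho> - a)" if "o2 \<le> \<rho>" "\<rho> < \<sigma>" for \<rho> \<sigma>
  proof -
    have "v (s \<sigma> - s \<rho>) < v (s \<rho> - a)" using div[of o1 \<rho> \<sigma>] that o2 by (simp add: a_def)
    from v_add_eq[OF this] this show ?thesis by simp
  qed
  have nz: "s \<nu> - a \<noteq> 0" if "o2 < \<nu>" for \<nu>
    using less[OF _ that] v_less_infinity[of "s \<nu> - a"] by (metis less_extended_simps(4) order.refl v_eq_infinity)
  \<comment> \<open>At \<open>o2\<close> itself the difference to \<open>a\<close> may vanish:
    pseudo-divergence allows the first two terms to agree.\<close>
  obtain N where N: "o2 < N" using gt_ex by blast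
  let ?q = "[:-a, 1:]"
  have "strict_values (\<lambda>\<nu>. s \<nu> - a)"
    unfolding strict_values_def using N less nz
    by (intro exI[of _ N] conjI disjI2) (auto dest: order_less_le_trans)
  then have "strict_values (\<lambda>\<nu>. poly ?q (s \<nu>))" by simp
  moreover have "inj_on s {N..}"
  proof (rule linorder_inj_onI')
    fix \<nu> \<mu> assume "\<nu> \<in> {N..}" "\<mu> \<in> {N..}" "\<nu> < \<mu>"
    then have "v (s \<mu> - a) < v (s \<nu> - a)" using less N by simp
    then show "s \<nu> \<noteq> s \<mu>" by auto
  qed
  ultimately have "monomial_values s (\<lambda>\<nu>. poly ?q (s \<nu>))"
    by (intro monomial_values_adic) (auto intro: constant_value_degree_0)
  then show ?thesis by blast
qed

text \<open>For \<open>d = 1\<close> and \<open>b = 1\<close> this is the fact that a nonzero polynomial over the residue field has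
  finitely many roots; the scaling by \<open>d\<close> and \<open>b\<close> avoids passing to the residue field.\<close>

lemma coeff_value_greater:
  assumes "infinite {t\<in>T. v b < v (poly f t)}" "b \<noteq> 0" "d \<noteq> 0"
    and "\<And>t. t \<in> T \<Longrightarrow> v d \<le> v t"
    and "\<And>t u. t \<in> T \<Longrightarrow> u \<in> T \<Longrightarrow> t \<noteq> u \<Longrightarrow> v (t - u) = v d"
  shows "v b < v (coeff f i * d ^ i)"
  using assms(1,2)
proof (induction "degree f" arbitrary: f b i)
  case 0
  then obtain c where f: "f = [:c:]" by (metis degree_eq_zeroE)
  from "0.prems"(1) have "{t\<in>T. v b < v (poly f t)} \<noteq> {}" by (metis finite.emptyI)
  then have "v b < v c" by (auto simp: f)
  then show ?case using "0.prems"(2) by (cases i) (auto simp: f)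
next
  case (Suc n)
  let ?B = "{t\<in>T. v b < v (poly f t)}"
  obtain t0 where t0: "t0 \<in> T" "v b < v (poly f t0)"
    using Suc.prems(1) by (metis (mono_tags, lifting) finite.emptyI mem_Collect_eq equals0I)
  \<comment> \<open>Since f(t) - f(t0) = h(t)(t - t0) and all differences have value
    \<open>v d\<close>, the quotient \<open>h\<close> satisfies the hypothesis with
    \<open>b / d\<close> in place of \<open>b\<close>, and its degree is smaller by one.\<close>
  define h where "h = synthetic_div f t0"
  have fh: "f = pCons (poly f t0) h - smult t0 h"
    using synthetic_div_correct[of f t0] by (simp add: h_def algebra_simps)
  have poly_h: "poly f t - poly f t0 = poly h t * (t - t0)" for t
    by (subst fh) (simp add: algebra_simps)
  have "v (b / d) < v (poly h t)" if "t \<in> ?B - {t0}" for t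
  proof -
    have "v b < min (v (poly f t)) (v (- poly f t0))" using that t0 by simp
    also have "\<dots> \<le> v (poly f t - poly f t0)" using v_add_ge[of "poly f t" "- poly f t0"] by simp
    also have "\<dots> = v (poly h t * d)"
      using poly_h[of t] assms(5)[of t t0] that t0 by (simp add: v_mult)
    finally have "v (b / d * d) < v (poly h t * d)" using assms(3) by simp
    then show ?thesis using v_mult_cancel[OF assms(3)] by (metis not_less)
  qed
  then have "?B - {t0} \<subseteq> {t\<in>T. v (b / d) < v (poly h t)}" by auto
  then have "infinite {t\<in>T. v (b / d) < v (poly h t)}"
    using Suc.prems(1) by (meson finite_Diff2 finite.emptyI finite_insert finite_subset)
  moreover have "degree h = n" using Suc.hyps(2) by (simp add: h_def degree_synthetic_div)
  ultimately have IH: "v (b / d) < v (coeff h j * d ^ j)" for j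
    using Suc.hyps(1)[of h "b / d" j] Suc.prems(2) assms(3) by simp
  have IH': "v b < v (coeff h j * d ^ j * d)" for j
    using v_mult_strict_right[OF IH[of j] assms(3)] assms(3) by simp
  \<comment> \<open>Coefficient 0 is f(t0), large by the choice of \<open>t0\<close>; coefficient i
    > 0 is coefficient i - 1 of \<open>h\<close>, and the missing factor \<open>d\<close> turns the
    bound \<open>b / d\<close> into \<open>b\<close>.\<close>
  have "v b < v (coeff (pCons (poly f t0) h) i * d ^ i)"
    using IH'[of "i - 1"] t0(2) by (cases i) (auto simp: mult_ac)
  moreover have "v b < v (- (t0 * coeff h i) * d ^ i)"
  proof -
    have "v (coeff h i * d ^ i * d) \<le> v (coeff h i * d ^ i * t0)"
      using assms(4)[OF t0(1)] by (intro v_mult_mono) auto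
    with IH'[of i] have "v b < v (coeff h i * d ^ i * t0)" by (rule order_less_le_trans)
    moreover have "- (t0 * coeff h i) * d ^ i = - (coeff h i * d ^ i * t0)" by (simp add: mult_ac)
    ultimately show ?thesis by (simp only: v_minus)
  qed
  ultimately have "v b < min (v (coeff (pCons (poly f t0) h) i * d ^ i)) (v (- (t0 * coeff h i) * d ^ i))"
    by simp
  also have "\<dots> \<le> v (coeff (pCons (poly f t0) h) i * d ^ i + - (t0 * coeff h i) * d ^ i)"
    by (rule v_add_ge)
  also have "coeff (pCons (poly f t0) h) i * d ^ i + - (t0 * coeff h i) * d ^ i = coeff f i * d ^ i"
    using arg_cong[OF fh, of "\<lambda>p. coeff p i * d ^ i"] by (simp add: algebra_simps)
  finally show ?case .
qed

text \<open>After a shift, \<open>v b\<close> is the least value of the terms g_i d^i. It bounds the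
  values of \<open>g\<close> along the sequence from below. If it were exceeded infinitely often,
  \<open>coeff_value_greater\<close> would make the minimal term exceed itself; so all values are
  eventually \<open>v b\<close>.\<close>

lemma monomial_values_pseudo_stationary:
  fixes s :: "'i::{wellorder, no_top} \<Rightarrow> 'a"
  assumes stat: "pseudo_stationary v s" and "s \<nu>\<^sub>0 \<noteq> s \<mu>\<^sub>0"
  shows "\<exists>d. monomial_values s d"
proof -
  define d where "d = s \<mu>\<^sub>0 - s \<nu>\<^sub>0"
  have d: "d \<noteq> 0" using assms(2) by (simp add: d_def)
  have "\<mu>\<^sub>0 \<noteq> \<nu>\<^sub>0" using assms(2) by auto
  then have vd: "v (s \<nu> - s \<mu>) = v d" if "\<nu> \<noteq> \<mu>" for \<nu> \<mu>
    using stat that unfolding pseudo_stationary_def d_def by blast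
  have inj: "inj s"
  proof (rule injI)
    fix \<nu> \<mu> assume "s \<nu> = s \<mu>"
    then show "\<nu> = \<mu>" using vd[of \<nu> \<mu>] d by (metis diff_self v_eq_infinity)
  qed
  define t where "t \<nu> = s \<nu> - s \<nu>\<^sub>0" for \<nu>
  have inj_t: "inj t" using inj by (auto simp: t_def inj_def)
  have "constant_value s f" for f
  proof (cases "f = 0")
    case True
    then show ?thesis by (simp add: constant_value_degree_0)
  next
    case False
    define g where "g = pcompose f [:s \<nu>\<^sub>0, 1:]"
    have g: "g \<noteq> 0" using False by (simp add: g_def pcompose_eq_0_iff)
    have poly_g: "poly f (s \<nu>) = poly g (t \<nu>)" for \<nu> by (simp add: g_def t_def poly_pcompose)
    \<comment> \<open>This index attains the Gauss valuation of g(dX); beyond the degree the terms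
      have value infinity.\<close>
    define j where "j = arg_min_on (\<lambda>i. v (coeff g i * d ^ i)) {..degree g}"
    define b where "b = coeff g j * d ^ j"
    have j: "v b \<le> v (coeff g i * d ^ i)" for i
    proof (cases "i \<le> degree g")
      case True
      then show ?thesis unfolding b_def j_def by (intro arg_min_least) auto
    next
      case False
      then show ?thesis by (simp add: coeff_eq_0)
    qed
    have "coeff g (degree g) * d ^ degree g \<noteq> 0" using g d by simp
    then have b: "b \<noteq> 0" using j[of "degree g"] by (metis Pinf_le v_eq_infinity)
    \<comment> \<open>Only an inequality, because \<open>t\<close> is 0 at the base index.\<close>
    have t: "v d \<le> v x" if "x \<in> range t" for x
    proof -
      from that obtain \<nu> where "x = s \<nu> - s \<nu>\<^sub>0" by (auto simp: t_def)
      then show ?thesis using vd[of \<nu> "\<nu>\<^sub>0"] by (cases "\<nu> = \<nu>\<^sub>0") auto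
    qed
    have "finite {x\<in>range t. v b < v (poly g x)}"
    proof (rule ccontr)
      assume inf: "infinite {x\<in>range t. v b < v (poly g x)}"
      have "v (x - y) = v d" if xy: "x \<in> range t" "y \<in> range t" "x \<noteq> y" for x y
      proof -
        obtain \<nu> \<mu> where "x = t \<nu>" "y = t \<mu>" using xy by auto
        then show ?thesis using vd[of \<nu> \<mu>] xy(3) by (cases "\<nu> = \<mu>") (auto simp: t_def)
      qed
      from coeff_value_greater[OF inf b d t this, of j] show False by (simp add: b_def)
    qed
    then have "finite (t ` {\<nu>. v b < v (poly g (t \<nu>))})"
      by (rule finite_subset[rotated]) auto
    then have "finite {\<nu>. v b < v (poly g (t \<nu>))}"
      using inj_t by (metis finite_imageD inj_on_subset subset_UNIV)
    from eventually_not_in_finite[OF this] have "\<forall>\<^sub>F \<nu> in at_top. v (poly f (s \<nu>)) = v b"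
    proof eventually_elim
      case (elim \<nu>)
      have "v b \<le> v (poly g (t \<nu>))"
        unfolding poly_altdef
      proof (rule v_sum_ge)
        fix i
        have "v (coeff g i * d ^ i) \<le> v (coeff g i * t \<nu> ^ i)"
          by (intro v_mult_mono v_power_mono order.refl t) simp
        with j[of i] show "v b \<le> v (coeff g i * t \<nu> ^ i)" by (rule order.trans)
      qed
      with elim show ?case by (simp add: poly_g not_less)
    qed
    then show ?thesis by (auto simp: constant_value_def)
  qed
  moreover have "inj_on s {\<nu>\<^sub>0..}" using inj by (rule inj_on_subset) simp
  ultimately show ?thesis using monomial_values_constant by blast
qed

text \<open>If \<open>y\<close> has smaller value than \<open>e\<close> at one index, adding later
  differences no longer changes its value. Otherwise \<open>v (y \<nu>)\<close> is never below
  \<open>v (e \<nu>)\<close>; were it larger at \<nu>, later terms would be stuck at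
  \<open>v (e \<nu>)\<close> and fall below \<open>e\<close>. So both values agree and
  increase.\<close>

lemma constant_or_strict_values:
  fixes y e :: "'i::{linorder, no_top} \<Rightarrow> 'a"
  assumes diff: "\<And>\<nu> \<sigma>. N \<le> \<nu> \<Longrightarrow> \<nu> < \<sigma> \<Longrightarrow> v (y \<sigma> - y \<nu>) = v (e \<nu>)"
    and less: "\<And>\<nu> \<sigma>. N \<le> \<nu> \<Longrightarrow> \<nu> < \<sigma> \<Longrightarrow> v (e \<nu>) < v (e \<sigma>)"
  shows "(\<exists>c. \<forall>\<^sub>F \<nu> in at_top. v (y \<nu>) = v c) \<or> strict_values y"
proof (cases "\<exists>\<nu>\<ge>N. v (y \<nu>) < v (e \<nu>)")
  case True
  then obtain \<nu> where \<nu>: "N \<le> \<nu>" "v (y \<nu>) < v (e \<nu>)" by blast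
  have "v (y \<sigma>) = v (y \<nu>)" if "\<nu> < \<sigma>" for \<sigma>
    using v_add_eq[of "y \<nu>" "y \<sigma> - y \<nu>"] diff[OF \<nu>(1) that] \<nu>(2) by simp
  then have "\<forall>\<^sub>F \<sigma> in at_top. v (y \<sigma>) = v (y \<nu>)"
    using eventually_gt_at_top[of \<nu>] by (rule eventually_mono[rotated])
  then show ?thesis by blast
next
  case False
  have eq: "v (y \<nu>) = v (e \<nu>)" if \<nu>: "N \<le> \<nu>" for \<nu>
  proof (rule ccontr)
    assume "v (y \<nu>) \<noteq> v (e \<nu>)"
    with False \<nu> have *: "v (e \<nu>) < v (y \<nu>)" by (metis linorder_cases)
    obtain \<sigma> where \<sigma>: "\<nu> < \<sigma>" using gt_ex by blast
    have "v (y \<sigma>) = v (e \<nu>)"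
      using v_add_eq[of "y \<sigma> - y \<nu>" "y \<nu>"] diff[OF \<nu> \<sigma>] * by simp
    then show False using less[OF \<nu> \<sigma>] False \<nu> \<sigma> by (metis less_imp_le order.trans)
  qed
  have "y \<nu> \<noteq> 0" if \<nu>: "N \<le> \<nu>" for \<nu>
  proof -
    obtain \<sigma> where \<sigma>: "\<nu> < \<sigma>" using gt_ex by blast
    show ?thesis using eq[OF \<nu>] less[OF \<nu> \<sigma>] by auto
  qed
  moreover have "v (y \<nu>) < v (y \<mu>)" if "N \<le> \<nu>" "\<nu> < \<mu>" for \<nu> \<mu>
    using less[OF that] eq that by simp
  ultimately show ?thesis unfolding strict_values_def by blast
qed

text \<open>In the Taylor expansion of q(s \<sigma>) - q(s \<nu>) all coefficients are of lower
  degree than the minimal \<open>q\<close>, so their values are eventually constant and one term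
  dominates. Thus \<open>q(s)\<close> behaves like a pseudo-convergent sequence, and as its values
  are not eventually constant they are strictly monotone.\<close>

lemma monomial_values_pseudo_convergent:
  fixes s :: "'i::{wellorder, no_top} \<Rightarrow> 'a"
  assumes "pseudo_convergent v s"
  shows "\<exists>d. monomial_values s d"
proof -
  have conv: "v (s \<rho> - s \<nu>) < v (s \<sigma> - s \<rho>)" if "\<nu> < \<rho>" "\<rho> < \<sigma>" for \<nu> \<rho> \<sigma>
    using assms that by (auto simp: pseudo_convergent_def)
  have same: "v (s \<tau> - s \<nu>) = v (s \<sigma> - s \<nu>)" if "\<nu> < \<sigma>" "\<sigma> < \<tau>" for \<nu> \<sigma> \<tau>
    using v_add_eq[OF conv[OF that]] by simp
  \<comment> \<open>Any later index would do: the value of s \<sigma> - s \<nu> is the same for all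
    \<sigma> > \<nu>.\<close>
  define d where "d \<nu> = s (SOME \<sigma>. \<nu> < \<sigma>) - s \<nu>" for \<nu>
  have d: "v (s \<sigma> - s \<nu>) = v (d \<nu>)" if "\<nu> < \<sigma>" for \<nu> \<sigma>
  proof -
    have "\<nu> < (SOME \<sigma>. \<nu> < \<sigma>)" using that by (rule someI)
    then show ?thesis unfolding d_def using same that by (metis linorder_cases)
  qed
  have less_d: "v (d \<nu>) < v (d \<mu>)" if \<nu>: "\<nu> < \<mu>" for \<nu> \<mu>
  proof -
    obtain \<sigma> where \<sigma>: "\<mu> < \<sigma>" using gt_ex by blast
    show ?thesis using conv[OF \<nu> \<sigma>] d[OF \<nu>] d[OF \<sigma>] by simp
  qed
  have d_nz: "d \<nu> \<noteq> 0" for \<nu>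
  proof -
    obtain \<mu> where "\<nu> < \<mu>" using gt_ex by blast
    from less_d[OF this] show ?thesis by auto
  qed
  have strict_d: "strict_values d" using less_d d_nz by (auto simp: strict_values_def)
  have inj: "inj s"
  proof (rule linorder_injI)
    fix \<nu> \<mu> :: 'i assume "\<nu> < \<mu>"
    from d[OF this] d_nz[of \<nu>] show "s \<nu> \<noteq> s \<mu>" by (metis diff_self v_eq_infinity)
  qed
  then have inj': "inj_on s {N..}" for N by (rule inj_on_subset) simp
  show ?thesis
  proof (cases "\<forall>f. constant_value s f")
    case True
    then show ?thesis using monomial_values_constant[OF inj'] by blast
  next
    case False
    define q where "q = arg_min degree (\<lambda>q. \<not> constant_value s q)"
    have q: "\<not> constant_value s q"
      using False arg_min_natI[of "\<lambda>q. \<not> constant_value s q" _ degree] by (auto simp: q_def)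
    have min_q: "constant_value s r" if "degree r < degree q" for r
      using that arg_min_nat_le[of "\<lambda>q. \<not> constant_value s q" r degree] by (auto simp: q_def)
    have deg_q: "0 < degree q" using q constant_value_degree_0 by (metis gr0I)
    define n where "n = degree q"
    obtain F where F: "F 0 = q" "\<And>i. degree (F i) \<le> n - i"
      "\<And>x y. poly q (x + y) = (\<Sum>i\<le>n. poly (F i) x * y ^ i)"
      using taylor_poly[of q n] by (auto simp: n_def)
    have "\<exists>c. \<forall>\<^sub>F \<nu> in at_top. v (poly (F i) (s \<nu>)) = v c" if "i \<in> {1..n}" for i
    proof -
      have "degree (F i) < degree q" using F(2)[of i] that by (auto simp: n_def)
      from min_q[OF this] show ?thesis by (simp add: constant_value_def)
    qed
    then obtain \<alpha> where \<alpha>: "\<And>i. i \<in> {1..n} \<Longrightarrow> \<forall>\<^sub>F \<nu> in at_top. v (poly (F i) (s \<nu>)) = v (\<alpha> i)"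
      by metis
    have \<alpha>_all: "\<forall>\<^sub>F \<nu> in at_top. \<forall>i\<in>{1..n}. v (poly (F i) (s \<nu>)) = v (\<alpha> i)"
      using \<alpha> by (intro eventually_ball_finite) auto
    have diff: "poly q (s \<sigma>) - poly q (s \<nu>) = (\<Sum>i=1..n. poly (F i) (s \<nu>) * (s \<sigma> - s \<nu>) ^ i)" for \<nu> \<sigma>
    proof -
      have "{..n} = insert 0 {1..n}" by auto
      then show ?thesis using F(3)[of "s \<nu>" "s \<sigma> - s \<nu>"] by (simp add: F(1))
    qed
    \<comment> \<open>Otherwise the Taylor coefficients of positive index vanish at some
      \<open>s N\<close>, and \<open>q\<close> is constant along the whole sequence.\<close>
    have "\<exists>j\<in>{1..n}. \<alpha> j \<noteq> 0"
    proof (rule ccontr)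
      assume zero: "\<not> (\<exists>j\<in>{1..n}. \<alpha> j \<noteq> 0)"
      obtain N where N: "\<And>\<nu>. N \<le> \<nu> \<Longrightarrow> \<forall>i\<in>{1..n}. v (poly (F i) (s \<nu>)) = v (\<alpha> i)"
        using \<alpha>_all by (auto simp: eventually_at_top_linorder)
      have "poly (F i) (s N) = 0" if "i \<in> {1..n}" for i
        using N[of N] zero that by fastforce
      then have "poly q (s \<sigma>) - poly q (s N) = 0" for \<sigma> unfolding diff by simp
      then have "v (poly q (s \<sigma>)) = v (poly q (s N))" for \<sigma> by (metis right_minus_eq)
      then have "\<forall>\<^sub>F \<sigma> in at_top. v (poly q (s \<sigma>)) = v (poly q (s N))"
        by (intro always_eventually allI)
      with q show False unfolding constant_value_def by blast
    qed
    from monomial_dominant[OF strict_d _ this] obtain j where j: "j \<in> {1..n}" "\<alpha> j \<noteq> 0"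
      and dom: "\<forall>\<^sub>F \<nu> in at_top. \<forall>i\<in>{1..n} - {j}. v (\<alpha> j * d \<nu> ^ j) < v (\<alpha> i * d \<nu> ^ i)"
      by blast
    obtain N where N: "\<And>\<nu> i. N \<le> \<nu> \<Longrightarrow> i \<in> {1..n} \<Longrightarrow> v (poly (F i) (s \<nu>)) = v (\<alpha> i)"
      "\<And>\<nu> i. N \<le> \<nu> \<Longrightarrow> i \<in> {1..n} - {j} \<Longrightarrow> v (\<alpha> j * d \<nu> ^ j) < v (\<alpha> i * d \<nu> ^ i)"
      using eventually_conj[OF \<alpha>_all dom] unfolding eventually_at_top_linorder by blast
    have "v (poly q (s \<sigma>) - poly q (s \<nu>)) = v (\<alpha> j * d \<nu> ^ j)" if \<nu>: "N \<le> \<nu>" "\<nu> < \<sigma>" for \<nu> \<sigma>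
    proof -
      have eq: "v (poly (F i) (s \<nu>) * (s \<sigma> - s \<nu>) ^ i) = v (\<alpha> i * d \<nu> ^ i)" if "i \<in> {1..n}" for i
        using N(1)[OF \<nu>(1) that] v_power_cong[OF d[OF \<nu>(2)]] by (rule v_mult_cong)
      have nz: "poly (F j) (s \<nu>) * (s \<sigma> - s \<nu>) ^ j \<noteq> 0"
      proof -
        have "\<alpha> j * d \<nu> ^ j \<noteq> 0" using j(2) d_nz by simp
        then show ?thesis using eq[OF j(1)] v_eq_infinity by metis
      qed
      have "v (poly q (s \<sigma>) - poly q (s \<nu>)) = v (poly (F j) (s \<nu>) * (s \<sigma> - s \<nu>) ^ j)"
        unfolding diff using j(1) eq N(2)[OF \<nu>(1)] nz
        by (intro v_sum_dominant[where f = "\<lambda>i. poly (F i) (s \<nu>) * (s \<sigma> - s \<nu>) ^ i"]) auto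
      with eq[OF j(1)] show ?thesis by simp
    qed
    moreover have "v (\<alpha> j * d \<nu> ^ j) < v (\<alpha> j * d \<mu> ^ j)" if "\<nu> < \<mu>" for \<nu> \<mu>
      using v_mult_strict_right[OF v_power_strict_mono[OF less_d[OF that] d_nz] j(2), of j] j(1)
      by (simp add: mult.commute)
    ultimately have "strict_values (\<lambda>\<nu>. poly q (s \<nu>))"
      using constant_or_strict_values[of N "\<lambda>\<nu>. poly q (s \<nu>)" "\<lambda>\<nu>. \<alpha> j * d \<nu> ^ j"] q
      unfolding constant_value_def by blast
    from monomial_values_adic[OF inj' deg_q this min_q] show ?thesis by blast
  qed
qed

end

section \<open>Rational functions\<close>

lemma not_pole_cases:
  assumes "\<not> is_pole_at \<phi> a"
  obtains p q where "\<phi> = Fraction_Field.Fract p q" "poly q a \<noteq> 0"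
    "ratfun_eval \<phi> a = poly p a / poly q a"
  using assms ratfun_eval_Fract(2) unfolding is_pole_at_def by blast

lemma ratfun_eval_add:
  assumes "\<not> is_pole_at \<phi> a" "\<not> is_pole_at \<psi> a"
  shows "\<not> is_pole_at (\<phi> + \<psi>) a" "ratfun_eval (\<phi> + \<psi>) a = ratfun_eval \<phi> a + ratfun_eval \<psi> a"
proof -
  obtain p q where 1: "\<phi> = Fraction_Field.Fract p q" "poly q a \<noteq> 0"
    "ratfun_eval \<phi> a = poly p a / poly q a" using not_pole_cases[OF assms(1)] .
  obtain p' q' where 2: "\<psi> = Fraction_Field.Fract p' q'" "poly q' a \<noteq> 0"
    "ratfun_eval \<psi> a = poly p' a / poly q' a" using not_pole_cases[OF assms(2)] .
  have *: "\<phi> + \<psi> = Fraction_Field.Fract (p * q' + p' * q) (q * q')"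
    using 1 2 by (subst 1, subst 2, intro add_fract) auto
  have "poly (q * q') a \<noteq> 0" using 1 2 by simp
  from ratfun_eval_Fract[OF this, of "p * q' + p' * q"] 1 2
  show "\<not> is_pole_at (\<phi> + \<psi>) a" "ratfun_eval (\<phi> + \<psi>) a = ratfun_eval \<phi> a + ratfun_eval \<psi> a"
    unfolding * by (simp_all add: add_frac_eq)
qed

lemma ratfun_eval_mult:
  assumes "\<not> is_pole_at \<phi> a" "\<not> is_pole_at \<psi> a"
  shows "\<not> is_pole_at (\<phi> * \<psi>) a" "ratfun_eval (\<phi> * \<psi>) a = ratfun_eval \<phi> a * ratfun_eval \<psi> a"
proof -
  obtain p q where 1: "\<phi> = Fraction_Field.Fract p q" "poly q a \<noteq> 0"
    "ratfun_eval \<phi> a = poly p a / poly q a" using not_pole_cases[OF assms(1)] .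
  obtain p' q' where 2: "\<psi> = Fraction_Field.Fract p' q'" "poly q' a \<noteq> 0"
    "ratfun_eval \<psi> a = poly p' a / poly q' a" using not_pole_cases[OF assms(2)] .
  have *: "\<phi> * \<psi> = Fraction_Field.Fract (p * p') (q * q')"
    by (simp add: 1 2)
  have "poly (q * q') a \<noteq> 0" using 1 2 by simp
  from ratfun_eval_Fract[OF this, of "p * p'"] 1 2
  show "\<not> is_pole_at (\<phi> * \<psi>) a" "ratfun_eval (\<phi> * \<psi>) a = ratfun_eval \<phi> a * ratfun_eval \<psi> a"
    unfolding * by simp_all
qed

lemma ratfun_eval_const:
  "\<not> is_pole_at (Fraction_Field.Fract [:c:] 1) a" "ratfun_eval (Fraction_Field.Fract [:c:] 1) a = c"
  using ratfun_eval_Fract[of 1 a "[:c:]"] by simp_all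

text \<open>In a representation with denominator of least degree a common root \<open>a\<close>
  would allow cancelling X - a. This serves constant sequences, where a badly chosen representation
  could be 0/0 at every index.\<close>

lemma Fract_no_common_root:
  fixes \<phi> :: "'a::field poly fract"
  obtains p q where "\<phi> = Fraction_Field.Fract p q" "q \<noteq> 0" "poly p a \<noteq> 0 \<or> poly q a \<noteq> 0"
proof -
  define P where "P q \<longleftrightarrow> q \<noteq> 0 \<and> (\<exists>p. \<phi> = Fraction_Field.Fract p q)" for q
  have "\<exists>q. P q" unfolding P_def by (cases \<phi>) auto
  then obtain q where q: "P q" "\<And>r. P r \<Longrightarrow> degree q \<le> degree r"
    using ex_has_least_nat[of P _ degree] by metis
  then obtain p where p: "\<phi> = Fraction_Field.Fract p q" "q \<noteq> 0" by (auto simp: P_def)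
  have "poly p a \<noteq> 0 \<or> poly q a \<noteq> 0"
  proof (rule ccontr)
    assume "\<not> ?thesis"
    then obtain p' q' where eq: "p = [:-a, 1:] * p'" "q = [:-a, 1:] * q'"
      by (auto simp: poly_eq_0_iff_dvd elim!: dvdE)
    have q': "q' \<noteq> 0" using p(2) eq(2) by auto
    have "\<phi> = Fraction_Field.Fract p' q'"
      unfolding p(1) eq by (rule mult_fract_cancel) simp
    with q' have "P q'" by (auto simp: P_def)
    from q(2)[OF this] have "degree q \<le> degree q'" .
    moreover have "degree q = Suc (degree q')" unfolding eq(2) using q' by (subst degree_mult_eq) auto
    ultimately show False by simp
  qed
  with p show ?thesis using that by blast
qed

section \<open>The ring of eventually integral rational functions and its ideal of nonunits\<close>

context valued_field
begin

definition eventual_ring :: "('i::linorder \<Rightarrow> 'a) \<Rightarrow> 'a poly fract set" where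
  "eventual_ring s = {\<phi>. \<forall>\<^sub>F \<nu> in at_top. \<not> is_pole_at \<phi> (s \<nu>) \<and> 0 \<le> v (ratfun_eval \<phi> (s \<nu>))}"

definition eventual_ideal :: "('i::linorder \<Rightarrow> 'a) \<Rightarrow> 'a poly fract set" where
  "eventual_ideal s = {\<phi>. \<forall>\<^sub>F \<nu> in at_top. \<not> is_pole_at \<phi> (s \<nu>) \<and> 0 < v (ratfun_eval \<phi> (s \<nu>))}"

lemma eventual_ideal_subset: "eventual_ideal s \<subseteq> eventual_ring s"
  unfolding eventual_ideal_def eventual_ring_def by (auto elim!: eventually_mono)

lemma eventual_ring_add:
  assumes "\<phi> \<in> eventual_ring s" "\<psi> \<in> eventual_ring s"
  shows "\<phi> + \<psi> \<in> eventual_ring s"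
  using assms unfolding eventual_ring_def mem_Collect_eq
proof eventually_elim
  case (elim \<nu>)
  then have "0 \<le> min (v (ratfun_eval \<phi> (s \<nu>))) (v (ratfun_eval \<psi> (s \<nu>)))" by simp
  also have "\<dots> \<le> v (ratfun_eval \<phi> (s \<nu>) + ratfun_eval \<psi> (s \<nu>))" by (rule v_add_ge)
  finally show ?case using elim by (simp add: ratfun_eval_add)
qed

lemma eventual_ring_mult:
  assumes "\<phi> \<in> eventual_ring s" "\<psi> \<in> eventual_ring s"
  shows "\<phi> * \<psi> \<in> eventual_ring s"
  using assms unfolding eventual_ring_def mem_Collect_eq
proof eventually_elim
  case (elim \<nu>)
  then show ?case
    using v_mult_mono[of 1 "ratfun_eval \<phi> (s \<nu>)" 1 "ratfun_eval \<psi> (s \<nu>)"]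
    by (simp add: ratfun_eval_mult)
qed

lemma eventual_ideal_mult:
  assumes "\<phi> \<in> eventual_ideal s" "\<psi> \<in> eventual_ring s"
  shows "\<phi> * \<psi> \<in> eventual_ideal s"
  using assms unfolding eventual_ring_def eventual_ideal_def mem_Collect_eq
proof eventually_elim
  case (elim \<nu>)
  let ?x = "ratfun_eval \<phi> (s \<nu>)" and ?y = "ratfun_eval \<psi> (s \<nu>)"
  have "v 1 < v ?x" "v 1 \<le> v ?y" using elim by simp_all
  from v_mult_strict_mono[OF this] show ?case using elim by (simp add: ratfun_eval_mult)
qed

lemma const_in_eventual_ring: "0 \<le> v c \<Longrightarrow> Fraction_Field.Fract [:c:] 1 \<in> eventual_ring s"
  by (simp add: eventual_ring_def ratfun_eval_const)

lemma const_in_eventual_ideal: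
  fixes s :: "'i::linorder \<Rightarrow> 'a"
  shows "Fraction_Field.Fract [:c:] 1 \<in> eventual_ideal s \<longleftrightarrow> 0 < v c"
  by (simp add: eventual_ideal_def ratfun_eval_const)

lemma Fract_in_eventual_ideal:
  assumes "\<forall>\<^sub>F \<nu> in at_top. v (poly q (s \<nu>)) < v (poly p (s \<nu>))"
  shows "Fraction_Field.Fract p q \<in> eventual_ideal s"
  using assms unfolding eventual_ideal_def mem_Collect_eq
proof eventually_elim
  case (elim \<nu>)
  \<comment> \<open>The smaller side of a strict inequality is not infinity, which excludes a
    pole.\<close>
  then have "poly q (s \<nu>) \<noteq> 0" by auto
  with elim show ?case by (simp add: ratfun_eval_Fract v_divide_iff)
qed

lemma Fract_in_eventual_ring:
  assumes "\<forall>\<^sub>F \<nu> in at_top. poly q (s \<nu>) \<noteq> 0 \<and> v (poly q (s \<nu>)) \<le> v (poly p (s \<nu>))"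
  shows "Fraction_Field.Fract p q \<in> eventual_ring s"
  using assms unfolding eventual_ring_def mem_Collect_eq
  by eventually_elim (simp add: ratfun_eval_Fract v_divide_iff)

text \<open>The first assumption ensures that equal values are finite: where both polynomials
  vanish, infinity = infinity would say nothing about the quotient.\<close>

lemma Fract_trichotomy:
  assumes "\<forall>\<^sub>F \<nu> in at_top. poly p (s \<nu>) \<noteq> 0 \<or> poly q (s \<nu>) \<noteq> 0"
    and "(\<forall>\<^sub>F \<nu> in at_top. v (poly p (s \<nu>)) < v (poly q (s \<nu>))) \<or>
      (\<forall>\<^sub>F \<nu> in at_top. v (poly p (s \<nu>)) = v (poly q (s \<nu>))) \<or>
      (\<forall>\<^sub>F \<nu> in at_top. v (poly q (s \<nu>)) < v (poly p (s \<nu>)))"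
  shows "Fraction_Field.Fract p q \<in> eventual_ideal s \<or>
    (Fraction_Field.Fract p q \<in> eventual_ring s \<and> Fraction_Field.Fract q p \<in> eventual_ring s) \<or>
    Fraction_Field.Fract q p \<in> eventual_ideal s"
  using assms(2)
proof (elim disjE)
  assume eq: "\<forall>\<^sub>F \<nu> in at_top. v (poly p (s \<nu>)) = v (poly q (s \<nu>))"
  have nz: "\<forall>\<^sub>F \<nu> in at_top. poly p (s \<nu>) \<noteq> 0 \<and> poly q (s \<nu>) \<noteq> 0"
    using eq assms(1) by eventually_elim (metis v_eq_infinity)
  have "Fraction_Field.Fract p q \<in> eventual_ring s" "Fraction_Field.Fract q p \<in> eventual_ring s"
    using eventually_conj[OF eq nz] by (auto intro!: Fract_in_eventual_ring elim: eventually_mono)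
  then show ?thesis by blast
qed (use Fract_in_eventual_ideal in blast)+

text \<open>Both claims rest on this: one of a function and its inverse is eventually integral, and
  a function whose inverse is not eventually integral has eventually positive value.\<close>

lemma eventual_trichotomy:
  fixes s :: "'i::{wellorder, no_top} \<Rightarrow> 'a"
  assumes "pseudo_monotone v s"
  shows "\<phi> \<in> eventual_ideal s \<or> (\<phi> \<in> eventual_ring s \<and> inverse \<phi> \<in> eventual_ring s) \<or>
    inverse \<phi> \<in> eventual_ideal s"
\<comment> \<open>A nonzero polynomial may vanish at every term of a constant sequence, so this case
  is settled by evaluation at one point.\<close>
proof (cases "\<exists>a. \<forall>\<nu>. s \<nu> = a")
  case True
  then obtain a where a: "\<And>\<nu>. s \<nu> = a" by blast
  obtain p q where pq: "\<phi> = Fraction_Field.Fract p q" "poly p a \<noteq> 0 \<or> poly q a \<noteq> 0"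
    using Fract_no_common_root[of \<phi> a] by metis
  from Fract_trichotomy[of p s q] pq(2) show ?thesis
    unfolding pq(1) inverse_fract by (simp add: a) (metis linorder_cases)
next
  case False
  then obtain \<nu> \<mu> where ne: "s \<nu> \<noteq> s \<mu>" by metis
  have "\<exists>d. monomial_values s d"
    using assms monomial_values_pseudo_convergent monomial_values_pseudo_divergent
      monomial_values_pseudo_stationary[OF _ ne] unfolding pseudo_monotone_def by blast
  then obtain d where d: "monomial_values s d" by blast
  show ?thesis
  proof (cases "\<phi> = 0")
    case True
    have "Fraction_Field.Fract 0 1 \<in> eventual_ideal s" by (intro Fract_in_eventual_ideal) (simp add: zero_extended_def)
    then show ?thesis using True by (simp add: Zero_fract_def)
  next
    case False
    then obtain p q where pq: "\<phi> = Fraction_Field.Fract p q" "p \<noteq> 0" "q \<noteq> 0"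
      by (cases \<phi> rule: Fract_cases_nonzero) auto
    obtain b k where b: "b \<noteq> 0" "k = 0 \<or> strict_values d"
      "\<forall>\<^sub>F \<nu> in at_top. v (poly p (s \<nu>)) = v (b * d \<nu> ^ k)"
      using d pq(2) unfolding monomial_values_def by blast
    obtain c l where c: "c \<noteq> 0" "l = 0 \<or> strict_values d"
      "\<forall>\<^sub>F \<nu> in at_top. v (poly q (s \<nu>)) = v (c * d \<nu> ^ l)"
      using d pq(3) unfolding monomial_values_def by blast
    have "\<forall>\<^sub>F \<nu> in at_top. poly p (s \<nu>) \<noteq> 0 \<or> poly q (s \<nu>) \<noteq> 0"
      using b(3) monomial_nonzero[OF b(2,1)] by eventually_elim (metis v_eq_infinity)
    moreover have "(\<forall>\<^sub>F \<nu> in at_top. v (poly p (s \<nu>)) < v (poly q (s \<nu>))) \<or>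
      (\<forall>\<^sub>F \<nu> in at_top. v (poly p (s \<nu>)) = v (poly q (s \<nu>))) \<or>
      (\<forall>\<^sub>F \<nu> in at_top. v (poly q (s \<nu>)) < v (poly p (s \<nu>)))"
    proof -
      \<comment> \<open>Numerator and denominator are replaced by monomials in the same
        \<open>d\<close>.\<close>
      have eq: "\<forall>\<^sub>F \<nu> in at_top. v (b * d \<nu> ^ k) = v (poly p (s \<nu>)) \<and> v (c * d \<nu> ^ l) = v (poly q (s \<nu>))"
        using b(3) c(3) by eventually_elim simp
      have transfer: "\<forall>\<^sub>F \<nu> in at_top. R (v (poly p (s \<nu>))) (v (poly q (s \<nu>)))"
        if "\<forall>\<^sub>F \<nu> in at_top. R (v (b * d \<nu> ^ k)) (v (c * d \<nu> ^ l))" for R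
        using that eq by eventually_elim simp
      show ?thesis
        using monomial_compare[OF b(2) c(2) b(1) c(1)] transfer[of "(<)"] transfer[of "(=)"]
          transfer[of "\<lambda>x y. y < x"] by blast
    qed
    ultimately show ?thesis
      using Fract_trichotomy unfolding pq(1) inverse_fract by blast
  qed
qed

lemma valuation_domain_eventual_ring:
  fixes s :: "'i::{wellorder, no_top} \<Rightarrow> 'a"
  assumes "pseudo_monotone v s"
  shows "valuation_domain (eventual_ring s)"
proof (rule valuation_domainI)
  show one: "1 \<in> eventual_ring s"
    using const_in_eventual_ring[of 1 s] by (simp add: One_fract_def one_pCons)
  fix \<phi> assume \<phi>: "\<phi> \<in> eventual_ring s"
  have "- (1 :: 'a poly fract) = Fraction_Field.Fract [:-1:] 1"
    by (simp add: One_fract_def one_pCons)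
  then have "-1 \<in> eventual_ring s" using const_in_eventual_ring[of "-1" s] by simp
  from eventual_ring_mult[OF this \<phi>] show "- \<phi> \<in> eventual_ring s" by simp
next
  fix \<phi> show "\<phi> \<in> eventual_ring s \<or> inverse \<phi> \<in> eventual_ring s"
    using eventual_trichotomy[OF assms] eventual_ideal_subset by blast
qed (simp_all add: eventual_ring_mult eventual_ring_add)

text \<open>An element of the ideal with inverse in the ring would put 1, whose value is 0, into the
  ideal. Conversely, for a nonunit only the first case of the trichotomy remains.\<close>

lemma eventual_ideal_eq_nonunits:
  fixes s :: "'i::{wellorder, no_top} \<Rightarrow> 'a"
  assumes "pseudo_monotone v s"
  shows "eventual_ideal s = {\<phi> \<in> eventual_ring s. \<phi> = 0 \<or> inverse \<phi> \<notin> eventual_ring s}"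
proof -
  have zero: "0 \<in> eventual_ideal s"
    using const_in_eventual_ideal[of 0 s] by (simp add: Zero_fract_def zero_extended_def)
  have one: "1 \<notin> eventual_ideal s"
    using const_in_eventual_ideal[of 1 s] by (simp add: One_fract_def one_pCons)
  have "inverse \<phi> \<notin> eventual_ring s" if "\<phi> \<in> eventual_ideal s" "\<phi> \<noteq> 0" for \<phi>
    using eventual_ideal_mult[OF that(1), of "inverse \<phi>"] one that(2) by auto
  then show ?thesis
    using eventual_ideal_subset eventual_trichotomy[OF assms] zero by blast
qed

end

theorem theorem3p4:
  fixes V M :: "'a::field set"
    and v :: "'a \<Rightarrow> 'g::linordered_ab_group_add extended"
    and s :: "'i::{wellorder, no_top} \<Rightarrow> 'a"
    and V\<^sub>E M\<^sub>E :: "'a poly fract set"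
  assumes "valuation_domain V"
    and "unique_maximal_ideal M V"
    and "valuation_of v V"
    and "pseudo_monotone v s"
  defines "V\<^sub>E \<equiv> {\<phi>. \<forall>\<^sub>F \<nu> in at_top. \<not> is_pole_at \<phi> (s \<nu>) \<and> ratfun_eval \<phi> (s \<nu>) \<in> V}"
    and "M\<^sub>E \<equiv> {\<phi>. \<forall>\<^sub>F \<nu> in at_top. \<not> is_pole_at \<phi> (s \<nu>) \<and> ratfun_eval \<phi> (s \<nu>) \<in> M}"
  shows "valuation_domain V\<^sub>E \<and> unique_maximal_ideal M\<^sub>E V\<^sub>E"
proof -
  interpret valued_field v
    using assms(3) by unfold_locales (simp add: valuation_of_def)
  have V: "V = {x. 0 \<le> v x}" using assms(3) by (simp add: valuation_of_def)
  \<comment> \<open>Uniqueness identifies the given \<open>M\<close> with the nonunits of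
    \<open>V\<close>, which are then seen to be the elements of positive value.\<close>
  have "M = {x \<in> V. x = 0 \<or> inverse x \<notin> V}"
    using assms(2) unique_maximal_ideal_nonunits[OF assms(1)]
    unfolding unique_maximal_ideal_def by metis
  also have "\<dots> = {x. 0 < v x}"
  proof -
    have "x \<in> V \<and> (x = 0 \<or> inverse x \<notin> V) \<longleftrightarrow> 0 < v x" for x
    proof (cases "x = 0")
      case True
      then show ?thesis by (simp add: V zero_extended_def)
    next
      case False
      then show ?thesis using v_divide_iff(1)[of x 1] by (auto simp: V inverse_eq_divide)
    qed
    then show ?thesis by blast
  qed
  finally have M: "M = {x. 0 < v x}" .
  have VE: "V\<^sub>E = eventual_ring s" and ME: "M\<^sub>E = eventual_ideal s"
    by (simp_all add: V\<^sub>E_def M\<^sub>E_def V M eventual_ring_def eventual_ideal_def)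
  have "valuation_domain (eventual_ring s)" by (rule valuation_domain_eventual_ring[OF assms(4)])
  with unique_maximal_ideal_nonunits[OF this] show ?thesis
    unfolding VE ME eventual_ideal_eq_nonunits[OF assms(4)] by (rule conjI[rotated])
qed

end
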